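(* Assume hypothesis (H), $\mathbb{E}(f^2(X))<+\infty$, and $k/N^k\to 0$ as $k\to\infty$. Then, whether the allocations are computed with rule (a) at every step or with rule (b) at every step, the adaptive stratified estimator satisfies $$\sqrt{N^k}\,\big(\hat c^k-c\big)\xrightarrow[k\to\infty]{\text{in law}}\mathcal N(0,\sigma_*^2).$$
   Context: Setting. $X$ is an $\mathbb{R}^d$-valued random variable, $f:\mathbb{R}^d\to\mathbb{R}$ is measurable, and $(A_i)_{1\le i\le I}$ is a measurable partition of $\mathbb{R}^d$ with $p_i=\mathbb{P}(X\in A_i)>0$ known for all $i$. $X_i$ denotes a random variable with the conditional law of $X$ given $X\in A_i$, and $c=\mathbb{E}f(X)=\sum_{i=1}^I p_i\mathbb{E}f(X_i)$. When $\mathbb{E}f^2(X)<\infty$: $\sigma_i^2=\mathrm{Var}(f(X_i))$, $\sigma_*=\sum_{i=1}^I p_i\sigma_i$, and (when $\sigma_*>0$) $q_i^*=p_i\sigma_i/\sigma_*$. Hypothesis (H): $\sigma_i>0$ for at least one index $i$. $(X_i^j)_{1\le i\le I,\,j\ge 1}$ are independent random variables, $X_i^j$ having the law of $X_i$. Adaptive algorithm. Fix deterministic integers $0=N^0<N^1<N^2<\cdots$ with $N^k-N^{k-1}\ge I$ for all $k\ge1$, and set $N_i^0=0$ for all $i$. For each step $k\ge1$: (1) If $k=1$ set $\hat\sigma_i^0=1$ for all $i$; if $k>1$ set $\hat\sigma_i^{k-1}\ge 0$ by $(\hat\sigma_i^{k-1})^2=\frac{1}{N_i^{k-1}}\sum_{j=1}^{N_i^{k-1}}f(X_i^j)^2-\big(\frac{1}{N_i^{k-1}}\sum_{j=1}^{N_i^{k-1}}f(X_i^j)\big)^2$.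 (2) Let $L_k=N^k-N^{k-1}-I$. If $\hat\sigma_i^{k-1}=0$ for all $i$, set $m_i^k=p_iL_k$. Otherwise compute $m_i^k\ge0$ by the chosen rule: Rule (a): $m_i^k=\frac{p_i\hat\sigma_i^{k-1}}{\sum_{j=1}^I p_j\hat\sigma_j^{k-1}}L_k$. Rule (b): set $m_i^k=0$ for every $i$ with $\hat\sigma_i^{k-1}=0$. Let $J$ be the set of the remaining indices, and for $i\in J$ put $n_i=N_i^{k-1}+1$, $\alpha_i=p_i\hat\sigma_i^{k-1}$. Enumerate $J$ as $(1),\dots,(|J|)$ so that $n_{(i)}/\alpha_{(i)}$ is nonincreasing in $i$. Let $i^*$ be the largest $i\in\{1,\dots,|J|-1\}$ such that $\frac{n_{(i)}}{\alpha_{(i)}}\ge\frac{L_k+\sum_{j=i+1}^{|J|}n_{(j)}}{\sum_{j=i+1}^{|J|}\alpha_{(j)}}$, and $i^*=0$ if there is no such $i$. Set $m_{(i)}^k=0$ for $i\le i^*$ and $m_{(i)}^k=\alpha_{(i)}\frac{L_k+\sum_{j=i^*+1}^{|J|}n_{(j)}}{\sum_{j=i^*+1}^{|J|}\alpha_{(j)}}-n_{(i)}$ for $i>i^*$. (3) (Systematic sampling) $\tilde m_i^k=\lfloor m_1^k+\dots+m_i^k\rfloor-\lfloor m_1^k+\dots+m_{i-1}^k\rfloor$ (second term $0$ for $i=1$), and $N_i^k=N_i^{k-1}+1+\tilde m_i^k$; thus $\sum_i N_i^k=N^k$ and at least one new drawing is made in each stratum. (4) The estimator after step $k$ is $\hat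 c^k=\sum_{i=1}^I\frac{p_i}{N_i^k}\sum_{j=1}^{N_i^k}f(X_i^j)$. *)

theory Defs
  imports "HOL-Probability.Probability"
begin

datatype alloc_rule = RuleA | RuleB

definition emp_sd :: "(nat \<Rightarrow> nat \<Rightarrow> real) \<Rightarrow> nat \<Rightarrow> nat \<Rightarrow> real" where
  "emp_sd y i n = sqrt ((\<Sum>j=1..n. (y i j)^2) / real n - ((\<Sum>j=1..n. y i j) / real n)^2)"

(* Rule (b); s = sigma-hat^{k-1}, Nprev = N^{k-1}, L = L_k *)
definition ruleb_alloc ::
  "nat \<Rightarrow> (nat \<Rightarrow> real) \<Rightarrow> (nat \<Rightarrow> real) \<Rightarrow> (nat \<Rightarrow> nat) \<Rightarrow> real \<Rightarrow> nat \<Rightarrow> real" where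
  "ruleb_alloc I p s Nprev L = (let
     J = filter (\<lambda>i. s i \<noteq> 0) [1..<Suc I];
     n = (\<lambda>i. real (Nprev i) + 1);
     \<alpha> = (\<lambda>i. p i * s i);
     ord = sort_key (\<lambda>i. - (n i / \<alpha> i)) J;
     q = length J;
     lam = (\<lambda>t. (L + (\<Sum>j\<in>set (drop t ord). n j)) / (\<Sum>j\<in>set (drop t ord). \<alpha> j));
     C = {t\<in>{1..q-1}. n (ord ! (t-1)) / \<alpha> (ord ! (t-1)) \<ge> lam t};
     istar = (if C = {} then 0 else Max C)
   in (\<lambda>i. if i \<in> set (drop istar ord) then \<alpha> i * lam istar - n i else 0))"

definition alloc_m ::
  "alloc_rule \<Rightarrow> nat \<Rightarrow> (nat \<Rightarrow> real) \<Rightarrow> (nat \<Rightarrow> real) \<Rightarrow> (nat \<Rightarrow> nat) \<Rightarrow> real \<Rightarrow> nat \<Rightarrow> real" where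
  "alloc_m rule I p s Nprev L =
     (if \<forall>i\<in>{1..I}. s i = 0 then (\<lambda>i. p i * L)
      else (case rule of
              RuleA \<Rightarrow> (\<lambda>i. p i * s i / (\<Sum>j=1..I. p j * s j) * L)
            | RuleB \<Rightarrow> ruleb_alloc I p s Nprev L))"

(* systematic sampling rounding *)
definition sys_round :: "(nat \<Rightarrow> real) \<Rightarrow> nat \<Rightarrow> int" where
  "sys_round m i = \<lfloor>\<Sum>l=1..i. m l\<rfloor> - \<lfloor>\<Sum>l=1..i-1. m l\<rfloor>"

(* alloc_N rule I p Nseq y k i = N_i^k, with y i j = f(X_i^j) *)
fun alloc_N ::
  "alloc_rule \<Rightarrow> nat \<Rightarrow> (nat \<Rightarrow> real) \<Rightarrow> (nat \<Rightarrow> nat) \<Rightarrow> (nat \<Rightarrow> nat \<Rightarrow> real) \<Rightarrow> nat \<Rightarrow> nat \<Rightarrow> nat" where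
  "alloc_N rule I p Nseq y 0 = (\<lambda>i. 0)"
| "alloc_N rule I p Nseq y (Suc k) = (let
     Nprev = alloc_N rule I p Nseq y k;
     s = (if k = 0 then (\<lambda>i. 1) else (\<lambda>i. emp_sd y i (Nprev i)));
     L = real (Nseq (Suc k)) - real (Nseq k) - real I;
     m = alloc_m rule I p s Nprev L
   in (\<lambda>i. Nprev i + 1 + nat (sys_round m i)))"

definition strat_est ::
  "alloc_rule \<Rightarrow> nat \<Rightarrow> (nat \<Rightarrow> real) \<Rightarrow> (nat \<Rightarrow> nat) \<Rightarrow> (nat \<Rightarrow> nat \<Rightarrow> real) \<Rightarrow> nat \<Rightarrow> real" where
  "strat_est rule I p Nseq y k =
     (\<Sum>i=1..I. p i / real (alloc_N rule I p Nseq y k i) *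
        (\<Sum>j=1..alloc_N rule I p Nseq y k i. y i j))"

definition law_sd :: "'a measure \<Rightarrow> ('a \<Rightarrow> real) \<Rightarrow> real" where
  "law_sd \<nu> f = sqrt (\<integral>x. (f x - (\<integral>z. f z \<partial>\<nu>))^2 \<partial>\<nu>)"

end

theory Submission
  imports Defs
begin

text \<open>Put \<open>q\<^sub>i = p\<^sub>i \<sigma>\<^sub>i / \<sigma>\<^sub>*\<close>. Every stratum gets a new drawing at each step, so by the strong law the
  empirical standard deviations converge almost surely to \<open>\<sigma>\<^sub>i\<close>. With \<open>\<rho>\<close> the estimated optimal
  proportion, both rules then satisfy
  \<open>N\<^sub>i\<^sup>k \<le> max (\<rho> N\<^sup>k) (N\<^sub>i\<^sup>k\<^sup>-\<^sup>1 + \<rho> (N\<^sup>k - N\<^sup>k\<^sup>-\<^sup>1)) + 2\<close>; together with \<open>k / N\<^sup>k \<longlongrightarrow> 0\<close> this bounds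
  the upper limit of \<open>N\<^sub>i\<^sup>k / N\<^sup>k\<close> by \<open>q\<^sub>i\<close>, and since both sides sum to 1 the ratio converges to \<open>q\<^sub>i\<close>.
  Kolmogorov's maximal inequality allows the random sample sizes to be replaced by the
  deterministic ones \<open>\<lfloor>q\<^sub>i N\<^sup>k\<rfloor>\<close> (Anscombe's argument), for which the strata are independent. The
  central limit theorem in each stratum, characteristic functions and Levy's theorem conclude;
  a stratum with \<open>\<sigma>\<^sub>i = 0\<close> has no error almost surely.\<close>

section \<open>Kolmogorov's maximal inequality and the strong law of large numbers\<close>

text \<open>The obstacle is that the sample sizes are functions of the very values being averaged,
  which couples all strata. Anscombe's argument tolerates any such dependence: it asks only that
  \<open>N\<^sub>i\<^sup>k / N\<^sup>k\<close> have a constant limit. Hence all information about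
  the rules is compressed into the one-step bound. The maximum in it is due to rule (b): a stratum
  is either filled to the water level, and then holds at most the share \<rho> of the total, or is
  already above it and receives only the compulsory draw; rule (a) realises the second branch. The
  constant 2 covers one compulsory draw and one unit of rounding; it accumulates to 2k after k
  steps, which is why k has to be of smaller order than \<open>N\<^sup>k\<close>. The squares
  \<open>f(X)\<^sup>2\<close> have only a first moment, so the strong law is proved in its L1 form,
  by truncation. Measurability of the sample sizes is a task of its own under rule (b), because the
  sorting permutation varies with the sample point; the water level is recovered there from a
  monotone function.\<close>

lemma (in prob_space) indep_vars_reindex:
  assumes "indep_vars M' X I" "inj_on h L" "h ` L \<subseteq> I"
  shows "indep_vars (\<lambda>j. M' (h j)) (\<lambda>j. X (h j)) L"
proof -
  have "indep_vars (\<lambda>j. PiM {h j} M') (\<lambda>j \<omega>. restrict (\<lambda>i. X i \<omega>) {h j}) L"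
    by (rule indep_vars_restrict[OF assms(1)])
       (use assms(2,3) in \<open>auto simp: disjoint_family_on_def inj_on_def\<close>)
  from indep_vars_compose2[OF this, of "\<lambda>j g. g (h j)" "\<lambda>j. M' (h j)"] show ?thesis
    by simp
qed

text \<open>The walk frozen at its first exit from (-e, e), the overshoot included. Whether
  \<open>x m\<close> is added depends on earlier terms only, so the past stays independent of the
  new increment.\<close>

primrec stopped_sum :: "real \<Rightarrow> (nat \<Rightarrow> real) \<Rightarrow> nat \<Rightarrow> real" where
  "stopped_sum e x 0 = 0"
| "stopped_sum e x (Suc m) = stopped_sum e x m + (if \<bar>stopped_sum e x m\<bar> < e then x m else 0)"

lemma stopped_sum_cong:
  "(\<And>i. i < m \<Longrightarrow> x i = y i) \<Longrightarrow> stopped_sum e x m = stopped_sum e y m"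
  by (induction m) auto

lemma measurable_stopped_sum:
  "(\<And>i. i < m \<Longrightarrow> (\<lambda>\<omega>. g \<omega> i) \<in> borel_measurable N) \<Longrightarrow>
     (\<lambda>\<omega>. stopped_sum e (g \<omega>) m) \<in> borel_measurable N"
proof (induction m)
  case (Suc m)
  have [measurable]: "(\<lambda>\<omega>. stopped_sum e (g \<omega>) m) \<in> borel_measurable N"
       "(\<lambda>\<omega>. g \<omega> m) \<in> borel_measurable N"
    using Suc by auto
  show ?case by simp
qed simp

text \<open>Turns a statement about all partial sums into one about a single variable: if some
  partial sum has left the interval, the final stopped value lies outside it.\<close>

lemma stopped_sum_alt:
  "\<bar>stopped_sum e x n\<bar> \<ge> e \<or> (stopped_sum e x n = (\<Sum>i<n. x i) \<and> (\<forall>m\<le>n. \<bar>\<Sum>i<m. x i\<bar> < e))"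
  by (induction n) (auto simp: le_Suc_eq not_le)

text \<open>In the expanded square the cross term has mean zero, being a function of the past times
  a centred independent variable, and each stopped increment has at most the second moment of
  \<open>X m\<close>.\<close>

lemma (in prob_space) square_stopped_sum:
  fixes X :: "nat \<Rightarrow> 'a \<Rightarrow> real"
  assumes indep: "indep_vars (\<lambda>_. borel) X {..<n}"
    and sq: "\<And>i. i < n \<Longrightarrow> integrable M (\<lambda>\<omega>. (X i \<omega>)\<^sup>2)"
    and mean: "\<And>i. i < n \<Longrightarrow> expectation (X i) = 0"
    and "m \<le> n"
  shows "integrable M (\<lambda>\<omega>. (stopped_sum e (\<lambda>i. X i \<omega>) m)\<^sup>2) \<and>
    expectation (\<lambda>\<omega>. (stopped_sum e (\<lambda>i. X i \<omega>) m)\<^sup>2) \<le> (\<Sum>i<m. expectation (\<lambda>\<omega>. (X i \<omega>)\<^sup>2))"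
  using \<open>m \<le> n\<close>
proof (induction m)
  case (Suc m)
  define T where "T = (\<lambda>\<omega>. stopped_sum e (\<lambda>i. X i \<omega>) m)"
  \<comment> \<open>In the cross term T V the indicator of not having left the interval is moved
    from the increment to the past: T V = W \<open>X m\<close>, where \<open>W\<close> depends on
    the terms before m only.\<close>
  define W where "W = (\<lambda>\<omega>. if \<bar>T \<omega>\<bar> < e then T \<omega> else 0)"
  define V where "V = (\<lambda>\<omega>. if \<bar>T \<omega>\<bar> < e then X m \<omega> else 0)"
  have X_meas [measurable]: "i < n \<Longrightarrow> X i \<in> borel_measurable M" for i
    using indep by (auto simp: indep_vars_def)
  have mn: "m < n" using Suc by simp
  have [measurable]: "X m \<in> borel_measurable M" using mn by simp
  have T_meas [measurable]: "T \<in> borel_measurable M"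
    unfolding T_def by (rule measurable_stopped_sum) (use mn in auto)
  have [measurable]: "W \<in> borel_measurable M" "V \<in> borel_measurable M"
    unfolding W_def V_def by measurable
  have T2: "integrable M (\<lambda>\<omega>. (T \<omega>)\<^sup>2)"
    and T2_le: "expectation (\<lambda>\<omega>. (T \<omega>)\<^sup>2) \<le> (\<Sum>i<m. expectation (\<lambda>\<omega>. (X i \<omega>)\<^sup>2))"
    using Suc unfolding T_def by auto
  have X2: "integrable M (\<lambda>\<omega>. (X m \<omega>)\<^sup>2)" using sq mn by simp
  have X1: "integrable M (X m)" by (rule square_integrable_imp_integrable[OF _ X2]) simp
  have T1: "integrable M T" by (rule square_integrable_imp_integrable[OF _ T2]) simp
  have W1: "integrable M W" by (rule Bochner_Integration.integrable_bound[OF T1]) (auto simp: W_def)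
  have V2: "integrable M (\<lambda>\<omega>. (V \<omega>)\<^sup>2)"
    by (rule Bochner_Integration.integrable_bound[OF X2]) (auto simp: V_def)
  have "indep_var borel ((\<lambda>x. if \<bar>stopped_sum e x m\<bar> < e then stopped_sum e x m else 0) \<circ>
             (\<lambda>\<omega>. restrict (\<lambda>i. X i \<omega>) {..<m}))
           borel ((\<lambda>x. x m) \<circ> (\<lambda>\<omega>. restrict (\<lambda>i. X i \<omega>) {m}))"
  proof (rule indep_var_compose[OF indep_var_restrict[OF indep]])
    have [measurable]: "(\<lambda>x. stopped_sum e x m) \<in> borel_measurable (Pi\<^sub>M {..<m} (\<lambda>_. borel))"
      by (rule measurable_stopped_sum) auto
    show "(\<lambda>x. if \<bar>stopped_sum e x m\<bar> < e then stopped_sum e x m else 0)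
        \<in> borel_measurable (Pi\<^sub>M {..<m} (\<lambda>_. borel))"
      by measurable
  qed (use mn in auto)
  also have "(\<lambda>x. if \<bar>stopped_sum e x m\<bar> < e then stopped_sum e x m else 0) \<circ>
             (\<lambda>\<omega>. restrict (\<lambda>i. X i \<omega>) {..<m}) = W"
  proof
    fix \<omega>
    have "stopped_sum e (restrict (\<lambda>i. X i \<omega>) {..<m}) m = T \<omega>"
      unfolding T_def by (rule stopped_sum_cong) simp
    then show "((\<lambda>x. if \<bar>stopped_sum e x m\<bar> < e then stopped_sum e x m else 0) \<circ>
             (\<lambda>\<omega>. restrict (\<lambda>i. X i \<omega>) {..<m})) \<omega> = W \<omega>"
      by (simp add: W_def)
  qed
  also have "(\<lambda>x. x m) \<circ> (\<lambda>\<omega>. restrict (\<lambda>i. X i \<omega>) {m}) = X m" by auto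
  finally have ind: "indep_var borel W borel (X m)" .
  have WX: "integrable M (\<lambda>\<omega>. W \<omega> * X m \<omega>)" "expectation (\<lambda>\<omega>. W \<omega> * X m \<omega>) = 0"
    using indep_var_integrable[OF ind W1 X1] indep_var_lebesgue_integral[OF ind W1 X1] mean mn
    by auto
  have eq: "(stopped_sum e (\<lambda>i. X i \<omega>) (Suc m))\<^sup>2 = (T \<omega>)\<^sup>2 + 2 * (W \<omega> * X m \<omega>) + (V \<omega>)\<^sup>2" for \<omega>
    by (simp add: T_def W_def V_def power2_sum)
  have "expectation (\<lambda>\<omega>. (V \<omega>)\<^sup>2) \<le> expectation (\<lambda>\<omega>. (X m \<omega>)\<^sup>2)"
    by (rule integral_mono[OF V2 X2]) (simp add: V_def)
  then show ?case
    unfolding eq using T2 T2_le WX V2 by simp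
qed simp

text \<open>Stopping the partial sums when they first leave the interval does not increase their
  variance, so Chebyshev's inequality for the stopped sum controls the maximum.\<close>

lemma (in prob_space) Kolmogorov_maximal_inequality:
  fixes X :: "nat \<Rightarrow> 'a \<Rightarrow> real"
  assumes indep: "indep_vars (\<lambda>_. borel) X {..<n}"
    and sq: "\<And>i. i < n \<Longrightarrow> integrable M (\<lambda>\<omega>. (X i \<omega>)\<^sup>2)"
    and mean: "\<And>i. i < n \<Longrightarrow> expectation (X i) = 0"
    and "e > 0"
  shows "prob {\<omega> \<in> space M. \<exists>m\<le>n. e \<le> \<bar>\<Sum>i<m. X i \<omega>\<bar>} \<le> (\<Sum>i<n. expectation (\<lambda>\<omega>. (X i \<omega>)\<^sup>2)) / e\<^sup>2"
proof -
  define T where "T = (\<lambda>\<omega>. stopped_sum e (\<lambda>i. X i \<omega>) n)"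
  have [measurable]: "T \<in> borel_measurable M"
    unfolding T_def by (rule measurable_stopped_sum) (use indep in \<open>auto simp: indep_vars_def\<close>)
  have T: "integrable M (\<lambda>\<omega>. (T \<omega>)\<^sup>2)"
      "expectation (\<lambda>\<omega>. (T \<omega>)\<^sup>2) \<le> (\<Sum>i<n. expectation (\<lambda>\<omega>. (X i \<omega>)\<^sup>2))"
    using square_stopped_sum[OF indep sq mean order_refl] unfolding T_def by auto
  have "prob {\<omega> \<in> space M. \<exists>m\<le>n. e \<le> \<bar>\<Sum>i<m. X i \<omega>\<bar>} \<le> prob {\<omega> \<in> space M. e\<^sup>2 \<le> (T \<omega>)\<^sup>2}"
  proof (rule finite_measure_mono)
    show "{\<omega> \<in> space M. \<exists>m\<le>n. e \<le> \<bar>\<Sum>i<m. X i \<omega>\<bar>} \<subseteq> {\<omega> \<in> space M. e\<^sup>2 \<le> (T \<omega>)\<^sup>2}"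
    proof safe
      fix \<omega> m assume "m \<le> n" "e \<le> \<bar>\<Sum>i<m. X i \<omega>\<bar>"
      with stopped_sum_alt[of e "\<lambda>i. X i \<omega>" n] have "e \<le> \<bar>T \<omega>\<bar>"
        unfolding T_def by force
      then show "e\<^sup>2 \<le> (T \<omega>)\<^sup>2" using \<open>e > 0\<close>
        by (metis abs_of_pos abs_le_square_iff)
    qed
  qed measurable
  also have "\<dots> \<le> expectation (\<lambda>\<omega>. (T \<omega>)\<^sup>2) / e\<^sup>2"
    by (rule integral_Markov_inequality_measure[OF T(1), where A="{}"]) (use \<open>e > 0\<close> in auto)
  also have "\<dots> \<le> (\<Sum>i<n. expectation (\<lambda>\<omega>. (X i \<omega>)\<^sup>2)) / e\<^sup>2"
    using T(2) by (rule divide_right_mono) simp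
  finally show ?thesis .
qed

section \<open>Averages, truncation estimates and the strong law\<close>

lemma Cesaro_mean:
  fixes a :: "nat \<Rightarrow> real"
  assumes "a \<longlonglongrightarrow> l"
  shows "(\<lambda>n. (\<Sum>i<n. a i) / real n) \<longlonglongrightarrow> l"
proof (rule LIMSEQ_I)
  fix e :: real assume "e > 0"
  obtain m where m: "\<And>i. i \<ge> m \<Longrightarrow> \<bar>a i - l\<bar> < e / 2"
    using LIMSEQ_D[OF assms, of "e / 2"] \<open>e > 0\<close> by auto
  define C where "C = (\<Sum>i<m. \<bar>a i - l\<bar>)"
  obtain n0 where n0: "real n0 > 2 * C / e" using reals_Archimedean2 by blast
  have "\<bar>(\<Sum>i<n. a i) / real n - l\<bar> < e" if "n \<ge> Suc (max m n0)" for n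
  proof -
    have n: "n > 0" "n \<ge> m" "n \<ge> n0" using that by auto
    have "\<bar>(\<Sum>i<n. a i) / real n - l\<bar> = \<bar>\<Sum>i<n. a i - l\<bar> / real n"
      using n by (simp add: sum_subtractf field_simps)
    also have "\<bar>\<Sum>i<n. a i - l\<bar> \<le> (\<Sum>i<n. \<bar>a i - l\<bar>)" by (rule sum_abs)
    also have "(\<Sum>i<n. \<bar>a i - l\<bar>) = C + (\<Sum>i\<in>{m..<n}. \<bar>a i - l\<bar>)"
      unfolding C_def lessThan_atLeast0 using n by (simp add: sum.atLeastLessThan_concat)
    also have "(\<Sum>i\<in>{m..<n}. \<bar>a i - l\<bar>) \<le> (\<Sum>i\<in>{m..<n}. e / 2)"
      by (rule sum_mono) (use m in \<open>auto intro: less_imp_le\<close>)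
    also have "\<dots> \<le> real n * (e / 2)" using \<open>e > 0\<close> by simp
    also have "C < real n * (e / 2)"
    proof -
      have "2 * C / e < real n" using n0 n by linarith
      then show ?thesis using \<open>e > 0\<close> by (simp add: field_simps)
    qed
    finally show ?thesis using n by (simp add: field_simps)
  qed
  then show "\<exists>n0. \<forall>n\<ge>n0. norm ((\<Sum>i<n. a i) / real n - l) < e" by auto
qed

text \<open>Induction by scaling: for |x| > 1 the term m = 0 vanishes and the rest is twice the sum
  for x / 2; for |x| \<le> 1 a geometric series and \<open>x\<^sup>2 \<le> \<bar>x\<bar>\<close>
  suffice.\<close>

lemma sum_dyadic_truncation_le:
  "(\<Sum>m<n. (1/2)^m * (if \<bar>x\<bar> \<le> 2^m then x\<^sup>2 else 0)) \<le> 2 * \<bar>x::real\<bar>"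
proof (induction n arbitrary: x)
  case (Suc n)
  show ?case
  proof (cases "\<bar>x\<bar> \<le> 1")
    case True
    have "(\<Sum>m<Suc n. (1/2)^m * (if \<bar>x\<bar> \<le> 2^m then x\<^sup>2 else 0)) \<le> (\<Sum>m<Suc n. (1/2)^m * x\<^sup>2)"
      by (rule sum_mono) simp
    also have "\<dots> = (\<Sum>m<Suc n. (1/2)^m) * x\<^sup>2" by (simp add: sum_distrib_right distrib_right)
    also have "(\<Sum>m<Suc n. (1/2::real)^m) \<le> 2"
      by (subst geometric_sum) auto
    also have "x\<^sup>2 \<le> \<bar>x\<bar>" using True mult_left_le[of "\<bar>x\<bar>" "\<bar>x\<bar>"] by (simp add: power2_eq_square flip: abs_mult)
    finally show ?thesis by (simp add: mult_right_mono)
  next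
    case False
    have "(\<Sum>m<Suc n. (1/2)^m * (if \<bar>x\<bar> \<le> 2^m then x\<^sup>2 else 0)) =
        (\<Sum>m<n. (1/2)^Suc m * (if \<bar>x\<bar> \<le> 2^Suc m then x\<^sup>2 else 0))"
      using False by (subst sum.lessThan_Suc_shift) simp
    also have "\<dots> = (\<Sum>m<n. 2 * ((1/2)^m * (if \<bar>x / 2\<bar> \<le> 2^m then (x / 2)\<^sup>2 else 0)))"
      by (rule sum.cong) (auto simp: power2_eq_square)
    also have "\<dots> \<le> 2 * (2 * \<bar>x / 2\<bar>)"
      unfolding sum_distrib_left[symmetric] using Suc[of "x / 2"] by simp
    finally show ?thesis by simp
  qed
qed simp

text \<open>Counts the integers j + 1 below |x|. Taking expectations gives the summability of P(|X|
  > j + 1) that Borel-Cantelli asks for.\<close>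

lemma sum_exceed_le: "(\<Sum>j<n. if \<bar>x\<bar> > real j + 1 then 1 else 0) \<le> \<bar>x::real\<bar>"
proof (induction n)
  case (Suc n)
  show ?case
  proof (cases "\<bar>x\<bar> > real n + 1")
    case True
    have "(\<Sum>j<Suc n. if \<bar>x\<bar> > real j + 1 then 1 else 0) \<le> (\<Sum>j<Suc n. 1 :: real)"
      by (rule sum_mono) simp
    then show ?thesis using True by simp
  qed (use Suc in simp)
qed simp

text \<open>Truncate at level \<open>j + 1\<close> and apply Kolmogorov's maximal inequality on dyadic blocks:
  the resulting probabilities are summable because \<open>\<Sum>m. 2\<^sup>-\<^sup>m x\<^sup>2 1(\<bar>x\<bar> \<le> 2\<^sup>m) \<le> 2 \<bar>x\<bar>\<close>.\<close>

theorem (in prob_space) strong_law_of_large_numbers: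
  fixes X :: "nat \<Rightarrow> 'a \<Rightarrow> real"
  assumes indep: "indep_vars (\<lambda>_. borel) X UNIV"
    and ident: "\<And>n. distr M borel (X n) = distr M borel (X 0)"
    and int: "integrable M (X 0)"
  shows "AE \<omega> in M. (\<lambda>n. (\<Sum>i<n. X i \<omega>) / real n) \<longlonglongrightarrow> expectation (X 0)"
proof -
  have X_meas [measurable]: "X n \<in> borel_measurable M" for n
    using indep by (auto simp: indep_vars_def)
  have transfer: "integrable M (\<lambda>\<omega>. g (X n \<omega>)) \<longleftrightarrow> integrable M (\<lambda>\<omega>. g (X 0 \<omega>))"
      "expectation (\<lambda>\<omega>. g (X n \<omega>)) = expectation (\<lambda>\<omega>. g (X 0 \<omega>))"
    if [measurable]: "g \<in> borel_measurable borel" for g :: "real \<Rightarrow> real" and n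
    using ident[of n] integrable_distr_eq[of "X n" M borel g] integrable_distr_eq[of "X 0" M borel g]
      integral_distr[of "X n" M borel g] integral_distr[of "X 0" M borel g] by auto
  define t where "t j x = (if \<bar>x\<bar> \<le> real j + 1 then x else 0 :: real)" for j x
  have t_meas [measurable]: "t j \<in> borel_measurable borel" for j
    unfolding t_def by measurable
  define h where "h m x = (if \<bar>x\<bar> \<le> 2^m then x\<^sup>2 else 0 :: real)" for m :: nat and x
  have h_meas [measurable]: "h m \<in> borel_measurable borel" for m
    unfolding h_def by measurable
  have t_int: "integrable M (\<lambda>\<omega>. t j (X k \<omega>))" for j k
    by (rule integrable_const_bound[where B = "real j + 1"]) (auto simp: t_def)
  have t2_int: "integrable M (\<lambda>\<omega>. (t j (X k \<omega>))\<^sup>2)" for j k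
    by (rule integrable_const_bound[where B = "(real j + 1)\<^sup>2"])
       (auto simp: t_def power2_le_iff_abs_le)
  have h_int: "integrable M (\<lambda>\<omega>. h j (X k \<omega>))" for j k
  proof (rule integrable_const_bound[where B = "(2^j)\<^sup>2"])
    have "x\<^sup>2 \<le> (2^j)\<^sup>2" if "\<bar>x\<bar> \<le> 2^j" for x :: real
      using that by (subst power2_le_iff_abs_le) auto
    then show "AE \<omega> in M. norm (h j (X k \<omega>)) \<le> (2^j)\<^sup>2" by (auto simp: h_def)
  qed measurable
  define a where "a j = expectation (\<lambda>\<omega>. t j (X j \<omega>))" for j
  define U where "U j \<omega> = t j (X j \<omega>) - a j" for j \<omega>
  have U_meas [measurable]: "U j \<in> borel_measurable M" for j
    unfolding U_def by measurable
  have U_indep: "indep_vars (\<lambda>_. borel) U UNIV"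
    unfolding U_def by (rule indep_vars_compose2[OF indep]) measurable
  have U2_int: "integrable M (\<lambda>\<omega>. (U j \<omega>)\<^sup>2)" for j
    unfolding U_def power2_diff using t_int t2_int by auto
  have U_mean: "expectation (U j) = 0" for j
    unfolding U_def using t_int by (simp add: a_def prob_space)
  \<comment> \<open>For j < 2^m the truncation level j + 1 is at most 2^m, so a single truncated
    second moment bounds every variance in the block.\<close>
  have U2_le: "expectation (\<lambda>\<omega>. (U j \<omega>)\<^sup>2) \<le> expectation (\<lambda>\<omega>. h m (X 0 \<omega>))" if "j < 2^m" for j m
  proof -
    have "real j + 1 \<le> 2^m"
      using that by (metis of_nat_numeral of_nat_power Suc_leI of_nat_Suc of_nat_le_iff add.commute)
    have "expectation (\<lambda>\<omega>. (U j \<omega>)\<^sup>2) = expectation (\<lambda>\<omega>. (t j (X j \<omega>))\<^sup>2) - (a j)\<^sup>2"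
      using variance_eq[OF t_int t2_int] by (simp add: U_def a_def)
    also have "\<dots> \<le> expectation (\<lambda>\<omega>. (t j (X j \<omega>))\<^sup>2)" by simp
    also have "\<dots> \<le> expectation (\<lambda>\<omega>. h m (X j \<omega>))"
      by (rule integral_mono[OF t2_int h_int]) (use \<open>real j + 1 \<le> 2^m\<close> in \<open>auto simp: t_def h_def\<close>)
    also have "\<dots> = expectation (\<lambda>\<omega>. h m (X 0 \<omega>))"
      by (rule transfer(2)) measurable
    finally show ?thesis .
  qed
  \<comment> \<open>The tolerances 1 / (r + 1) are countable, so the quantifier over them may be
    exchanged with the almost sure statement.\<close>
  have "AE \<omega> in M. \<forall>r::nat. eventually (\<lambda>m. \<forall>n\<le>2^m. \<bar>\<Sum>i<n. U i \<omega>\<bar> < 2^m / (real r + 1)) sequentially"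
    unfolding AE_all_countable
  proof
    fix r :: nat
    define B where "B m = {\<omega> \<in> space M. \<exists>n\<le>2^m. 2^m / (real r + 1) \<le> \<bar>\<Sum>i<n. U i \<omega>\<bar>}" for m :: nat
    \<comment> \<open>There are 2^m variances, and the squared threshold is
      \<open>(2^m / (r + 1))\<^sup>2\<close>; their quotient leaves the factor
      \<open>(1/2)^m\<close>.\<close>
    have prob_B: "prob (B m) \<le> (real r + 1)\<^sup>2 * ((1/2)^m * expectation (\<lambda>\<omega>. h m (X 0 \<omega>)))" for m
    proof -
      have "prob (B m) \<le> (\<Sum>i<2^m. expectation (\<lambda>\<omega>. (U i \<omega>)\<^sup>2)) / (2^m / (real r + 1))\<^sup>2"
        unfolding B_def
        by (rule Kolmogorov_maximal_inequality[OF indep_vars_subset[OF U_indep]])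
           (use U2_int U_mean in auto)
      also have "(\<Sum>i<2^m. expectation (\<lambda>\<omega>. (U i \<omega>)\<^sup>2)) \<le> (\<Sum>i<(2::nat)^m. expectation (\<lambda>\<omega>. h m (X 0 \<omega>)))"
        by (rule sum_mono) (use U2_le in auto)
      also have "(\<Sum>i<(2::nat)^m. expectation (\<lambda>\<omega>. h m (X 0 \<omega>))) / (2^m / (real r + 1))\<^sup>2 =
          (real r + 1)\<^sup>2 * ((1/2)^m * expectation (\<lambda>\<omega>. h m (X 0 \<omega>)))"
        by (simp add: field_simps power2_eq_square)
      finally show ?thesis by (simp add: divide_right_mono)
    qed
    have "summable (\<lambda>m. (1/2)^m * expectation (\<lambda>\<omega>. h m (X 0 \<omega>)))"
    proof (rule summableI_nonneg_bounded)
      show "0 \<le> (1/2)^m * expectation (\<lambda>\<omega>. h m (X 0 \<omega>))" for m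
        by (intro mult_nonneg_nonneg integral_nonneg_AE) (auto simp: h_def)
      fix n
      have "(\<Sum>m<n. (1/2)^m * expectation (\<lambda>\<omega>. h m (X 0 \<omega>))) = expectation (\<lambda>\<omega>. \<Sum>m<n. (1/2)^m * h m (X 0 \<omega>))"
        using h_int by simp
      also have "\<dots> \<le> expectation (\<lambda>\<omega>. 2 * \<bar>X 0 \<omega>\<bar>)"
        by (rule integral_mono)
           (use h_int int in \<open>auto simp: h_def intro!: sum_dyadic_truncation_le\<close>)
      finally show "(\<Sum>m<n. (1/2)^m * expectation (\<lambda>\<omega>. h m (X 0 \<omega>))) \<le> expectation (\<lambda>\<omega>. 2 * \<bar>X 0 \<omega>\<bar>)" .
    qed
    then have summ: "summable (\<lambda>m. prob (B m))"
      by (rule summable_comparison_test'[OF summable_mult[where c = "(real r + 1)\<^sup>2"], where N = 0])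
         (use prob_B in auto)
    have B_sets: "B m \<in> sets M" for m unfolding B_def by measurable
    have "AE \<omega> in M. eventually (\<lambda>m. \<omega> \<in> space M - B m) sequentially"
      by (rule borel_cantelli_AE1[OF B_sets _ summ]) (simp add: less_top[symmetric])
    then show "AE \<omega> in M. eventually (\<lambda>m. \<forall>n\<le>2^m. \<bar>\<Sum>i<n. U i \<omega>\<bar> < 2^m / (real r + 1)) sequentially"
      proof eventually_elim
      case (elim \<omega>)
      then show ?case
      proof (rule eventually_mono)
        fix m assume "\<omega> \<in> space M - B m"
        then show "\<forall>n\<le>2^m. \<bar>\<Sum>i<n. U i \<omega>\<bar> < 2^m / (real r + 1)"
          by (simp add: B_def not_le) (meson leD)
      qed
    qed
  qed
  then have U_lln: "AE \<omega> in M. (\<lambda>n. (\<Sum>i<n. U i \<omega>) / real n) \<longlonglongrightarrow> 0"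
  proof eventually_elim
    case (elim \<omega>)
    show ?case
    proof (rule LIMSEQ_I)
      fix e :: real assume "e > 0"
      \<comment> \<open>An index n with 2^m \<le> n < 2^(m+1) is controlled by the block of length
        2^(m+1), at most 2n; this factor 2 is built into the choice of r.\<close>
      obtain r :: nat where "real r > 2 / e" using reals_Archimedean2 by blast
      then have r: "2 / (real r + 1) < e" using \<open>e > 0\<close> by (simp add: field_simps)
      obtain m0 where m0: "\<And>m n. m \<ge> m0 \<Longrightarrow> n \<le> 2^m \<Longrightarrow> \<bar>\<Sum>i<n. U i \<omega>\<bar> < 2^m / (real r + 1)"
        using elim[THEN spec[of _ r]] unfolding eventually_sequentially by auto
      have "\<bar>(\<Sum>i<n. U i \<omega>) / real n\<bar> < e" if n: "n \<ge> 2^m0" for n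
      proof -
        have "n \<ge> 1" using n le_trans[of 1 "2^m0" n] by simp
        then obtain m where m: "2^m \<le> n" "n < 2^(m+1)" using ex_power_ivl1[of 2 n] by auto
        then have "(2::nat)^m0 < 2^(m+1)" using n by linarith
        then have "m0 < m + 1" by (simp only: power_strict_increasing_iff)
        then have "\<bar>\<Sum>i<n. U i \<omega>\<bar> < 2^(m+1) / (real r + 1)"
          using m by (intro m0) auto
        also have "\<dots> = 2 / (real r + 1) * 2^m" by simp
        also have "\<dots> \<le> 2 / (real r + 1) * real n"
          by (rule mult_left_mono) (use m(1) of_nat_mono[of "2^m" n] in auto)
        also have "\<dots> \<le> e * real n" by (rule mult_right_mono) (use r in auto)
        finally show ?thesis using \<open>n \<ge> 1\<close> by (simp add: field_simps)
      qed
      then show "\<exists>n0. \<forall>n\<ge>n0. norm ((\<Sum>i<n. U i \<omega>) / real n - 0) < e" by auto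
    qed
  qed
  \<comment> \<open>By Borel-Cantelli, \<open>X j\<close> and its truncation almost surely differ
    for finitely many j only.\<close>
  define E where "E j = {\<omega> \<in> space M. \<bar>X j \<omega>\<bar> > real j + 1}" for j
  have E_sets: "E j \<in> sets M" for j unfolding E_def by measurable
  have prob_E: "prob (E j) = expectation (\<lambda>\<omega>. if \<bar>X 0 \<omega>\<bar> > real j + 1 then 1 else 0)" for j
  proof -
    have "prob (E j) = expectation (indicator (E j))" by (simp add: E_sets)
    also have "\<dots> = expectation (\<lambda>\<omega>. if \<bar>X j \<omega>\<bar> > real j + 1 then 1 else 0)"
      by (rule Bochner_Integration.integral_cong) (auto simp: E_def)
    also have "\<dots> = expectation (\<lambda>\<omega>. if \<bar>X 0 \<omega>\<bar> > real j + 1 then 1 else 0)"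
      by (rule transfer(2)) measurable
    finally show ?thesis .
  qed
  have "summable (\<lambda>j. prob (E j))"
  proof (rule summableI_nonneg_bounded)
    fix n
    have i: "integrable M (\<lambda>\<omega>. if \<bar>X 0 \<omega>\<bar> > real j + 1 then 1 else 0 :: real)" for j
      by (rule integrable_const_bound[where B = 1]) auto
    have "(\<Sum>j<n. prob (E j)) = expectation (\<lambda>\<omega>. \<Sum>j<n. if \<bar>X 0 \<omega>\<bar> > real j + 1 then 1 else 0)"
      unfolding prob_E using i by simp
    also have "\<dots> \<le> expectation (\<lambda>\<omega>. \<bar>X 0 \<omega>\<bar>)"
      by (rule integral_mono) (use i int sum_exceed_le in auto)
    finally show "(\<Sum>j<n. prob (E j)) \<le> expectation (\<lambda>\<omega>. \<bar>X 0 \<omega>\<bar>)" .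
  qed simp
  then have "AE \<omega> in M. eventually (\<lambda>j. \<omega> \<in> space M - E j) sequentially"
    by (intro borel_cantelli_AE1[OF E_sets]) (simp_all add: less_top[symmetric])
  then have X_eq: "AE \<omega> in M. (\<lambda>j. X j \<omega> - t j (X j \<omega>)) \<longlonglongrightarrow> 0"
  proof eventually_elim
    case (elim \<omega>)
    then have "eventually (\<lambda>j. X j \<omega> - t j (X j \<omega>) = 0) sequentially"
      by eventually_elim (auto simp: E_def t_def)
    then show ?case by (rule tendsto_eventually)
  qed
  \<comment> \<open>The centring constants \<open>a j\<close> tend to the true mean by dominated
    convergence, hence so do their averages.\<close>
  have "(\<lambda>j. expectation (\<lambda>\<omega>. t j (X 0 \<omega>))) \<longlonglongrightarrow> expectation (X 0)"
  proof (rule integral_dominated_convergence[where w = "\<lambda>\<omega>. \<bar>X 0 \<omega>\<bar>"])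
    show "AE \<omega> in M. (\<lambda>j. t j (X 0 \<omega>)) \<longlonglongrightarrow> X 0 \<omega>"
    proof (rule AE_I2)
      fix \<omega>
      obtain k :: nat where "real k > \<bar>X 0 \<omega>\<bar>" using reals_Archimedean2 by blast
      then have "t j (X 0 \<omega>) = X 0 \<omega>" if "j \<ge> k" for j
        using that by (auto simp: t_def)
      then show "(\<lambda>j. t j (X 0 \<omega>)) \<longlonglongrightarrow> X 0 \<omega>"
        by (intro tendsto_eventually) (auto simp: eventually_sequentially)
    qed
  qed (use int in \<open>auto simp: t_def\<close>)
  also have "(\<lambda>j. expectation (\<lambda>\<omega>. t j (X 0 \<omega>))) = a"
    unfolding a_def by (rule ext) (rule transfer(2)[OF t_meas, symmetric])
  finally have a_lim: "a \<longlonglongrightarrow> expectation (X 0)" .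
  from U_lln X_eq show ?thesis
  proof eventually_elim
    case (elim \<omega>)
    have "(\<lambda>n. (\<Sum>i<n. U i \<omega>) / real n + (\<Sum>i<n. X i \<omega> - t i (X i \<omega>)) / real n + (\<Sum>i<n. a i) / real n)
        \<longlonglongrightarrow> 0 + 0 + expectation (X 0)"
      by (intro tendsto_add elim(1) Cesaro_mean[OF elim(2)] Cesaro_mean[OF a_lim])
    also have "(\<lambda>n. (\<Sum>i<n. U i \<omega>) / real n + (\<Sum>i<n. X i \<omega> - t i (X i \<omega>)) / real n + (\<Sum>i<n. a i) / real n)
        = (\<lambda>n. (\<Sum>i<n. X i \<omega>) / real n)"
      by (simp only: U_def sum_subtractf add_divide_distrib[symmetric]) simp
    finally show ?case by simp
  qed
qed

section \<open>Convergence in probability and Anscombe's theorem\<close>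

context prob_space
begin

text \<open>Convergence to 0 in probability, with measurability made part of the notion so that the
  closure lemmas deliver it together with the limit.\<close>

definition vanishes_in_prob :: "(nat \<Rightarrow> 'a \<Rightarrow> real) \<Rightarrow> bool" where
  "vanishes_in_prob R \<longleftrightarrow>
     (\<forall>k. R k \<in> borel_measurable M) \<and>
     (\<forall>e>0. (\<lambda>k. prob {\<omega> \<in> space M. \<bar>R k \<omega>\<bar> > e}) \<longlonglongrightarrow> 0)"

lemma vanishes_in_probD:
  "vanishes_in_prob R \<Longrightarrow> e > 0 \<Longrightarrow> (\<lambda>k. prob {\<omega> \<in> space M. \<bar>R k \<omega>\<bar> > e}) \<longlonglongrightarrow> 0"
  by (simp add: vanishes_in_prob_def)

lemma vanishes_in_prob_zero: "vanishes_in_prob (\<lambda>k \<omega>. 0)"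
  by (auto simp: vanishes_in_prob_def)

lemma vanishes_in_prob_add:
  assumes "vanishes_in_prob R" "vanishes_in_prob R'"
  shows "vanishes_in_prob (\<lambda>k \<omega>. R k \<omega> + R' k \<omega>)"
proof -
  have [measurable]: "R k \<in> borel_measurable M" "R' k \<in> borel_measurable M" for k
    using assms by (auto simp: vanishes_in_prob_def)
  have "(\<lambda>k. prob {\<omega> \<in> space M. \<bar>R k \<omega> + R' k \<omega>\<bar> > e}) \<longlonglongrightarrow> 0" if "e > 0" for e
  proof (rule tendsto_sandwich[OF _ _ tendsto_const])
    have "prob {\<omega> \<in> space M. \<bar>R k \<omega> + R' k \<omega>\<bar> > e} \<le>
        prob {\<omega> \<in> space M. \<bar>R k \<omega>\<bar> > e / 2} + prob {\<omega> \<in> space M. \<bar>R' k \<omega>\<bar> > e / 2}" for k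
      by (rule order_trans[OF finite_measure_mono measure_Un_le]) auto
    then show "eventually (\<lambda>k. prob {\<omega> \<in> space M. \<bar>R k \<omega> + R' k \<omega>\<bar> > e} \<le>
        prob {\<omega> \<in> space M. \<bar>R k \<omega>\<bar> > e / 2} + prob {\<omega> \<in> space M. \<bar>R' k \<omega>\<bar> > e / 2}) sequentially"
      by simp
    have "(\<lambda>k. prob {\<omega> \<in> space M. \<bar>R k \<omega>\<bar> > e / 2} + prob {\<omega> \<in> space M. \<bar>R' k \<omega>\<bar> > e / 2}) \<longlonglongrightarrow> 0 + 0"
      using \<open>e > 0\<close> by (intro tendsto_add vanishes_in_probD assms) auto
    then show "(\<lambda>k. prob {\<omega> \<in> space M. \<bar>R k \<omega>\<bar> > e / 2} + prob {\<omega> \<in> space M. \<bar>R' k \<omega>\<bar> > e / 2}) \<longlonglongrightarrow> 0"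
      by simp
  qed simp
  then show ?thesis by (simp add: vanishes_in_prob_def)
qed

lemma vanishes_in_prob_sum:
  "(\<And>i. i \<in> S \<Longrightarrow> vanishes_in_prob (R i)) \<Longrightarrow> vanishes_in_prob (\<lambda>k \<omega>. \<Sum>i\<in>S. R i k \<omega>)"
  by (induction S rule: infinite_finite_induct)
     (auto intro: vanishes_in_prob_zero vanishes_in_prob_add)

lemma vanishes_in_prob_AE:
  assumes [measurable]: "\<And>k. R k \<in> borel_measurable M" and lim: "AE \<omega> in M. (\<lambda>k. R k \<omega>) \<longlonglongrightarrow> 0"
  shows "vanishes_in_prob R"
proof -
  have "(\<lambda>k. prob {\<omega> \<in> space M. \<bar>R k \<omega>\<bar> > e}) \<longlonglongrightarrow> 0" if "e > 0" for e
  proof -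
    have "(\<lambda>k. expectation (indicator {\<omega> \<in> space M. \<bar>R k \<omega>\<bar> > e})) \<longlonglongrightarrow> expectation (\<lambda>_. 0 :: real)"
    proof (rule integral_dominated_convergence[where w = "\<lambda>_. 1"])
      show "AE \<omega> in M. (\<lambda>k. indicator {\<omega> \<in> space M. \<bar>R k \<omega>\<bar> > e} \<omega>) \<longlonglongrightarrow> (0 :: real)"
        using lim
      proof eventually_elim
        case (elim \<omega>)
        then have "eventually (\<lambda>k. \<bar>R k \<omega>\<bar> < e) sequentially"
          using \<open>e > 0\<close> by (intro order_tendstoD(2)[OF tendsto_rabs_zero]) auto
        then have "eventually (\<lambda>k. indicator {\<omega> \<in> space M. \<bar>R k \<omega>\<bar> > e} \<omega> = (0 :: real)) sequentially"
          by eventually_elim (auto simp: indicator_def)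
        then show ?case by (rule tendsto_eventually)
      qed
    qed (auto simp: indicator_def)
    then show ?thesis by simp
  qed
  then show ?thesis by (simp add: vanishes_in_prob_def)
qed

lemma vanishes_in_prob_mult:
  assumes R: "vanishes_in_prob R" and [measurable]: "\<And>k. B k \<in> borel_measurable M"
    and bdd: "\<And>d. d > 0 \<Longrightarrow> \<exists>K>0. eventually (\<lambda>k. prob {\<omega> \<in> space M. \<bar>B k \<omega>\<bar> > K} \<le> d) sequentially"
  shows "vanishes_in_prob (\<lambda>k \<omega>. B k \<omega> * R k \<omega>)"
proof -
  have [measurable]: "R k \<in> borel_measurable M" for k
    using R by (auto simp: vanishes_in_prob_def)
  have "(\<lambda>k. prob {\<omega> \<in> space M. \<bar>B k \<omega> * R k \<omega>\<bar> > e}) \<longlonglongrightarrow> 0" if "e > 0" for e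
  proof (rule order_tendstoI)
    fix d :: real assume "d > 0"
    obtain K where K: "K > 0" "eventually (\<lambda>k. prob {\<omega> \<in> space M. \<bar>B k \<omega>\<bar> > K} \<le> d / 2) sequentially"
      using bdd[of "d / 2"] \<open>d > 0\<close> by auto
    have "eventually (\<lambda>k. prob {\<omega> \<in> space M. \<bar>R k \<omega>\<bar> > e / K} < d / 2) sequentially"
      using R K(1) \<open>e > 0\<close> \<open>d > 0\<close> unfolding vanishes_in_prob_def
      by (intro order_tendstoD(2)[where y = 0]) auto
    then show "eventually (\<lambda>k. prob {\<omega> \<in> space M. \<bar>B k \<omega> * R k \<omega>\<bar> > e} < d) sequentially"
      using K(2)
    proof eventually_elim
      case (elim k)
      have "prob {\<omega> \<in> space M. \<bar>B k \<omega> * R k \<omega>\<bar> > e} \<le>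
          prob {\<omega> \<in> space M. \<bar>B k \<omega>\<bar> > K} + prob {\<omega> \<in> space M. \<bar>R k \<omega>\<bar> > e / K}"
      proof (rule order_trans[OF finite_measure_mono measure_Un_le])
        show "{\<omega> \<in> space M. \<bar>B k \<omega> * R k \<omega>\<bar> > e} \<subseteq>
            {\<omega> \<in> space M. \<bar>B k \<omega>\<bar> > K} \<union> {\<omega> \<in> space M. \<bar>R k \<omega>\<bar> > e / K}"
        proof (safe, rule ccontr)
          fix \<omega> assume "e < \<bar>B k \<omega> * R k \<omega>\<bar>" "\<not> e / K < \<bar>R k \<omega>\<bar>" "\<not> K < \<bar>B k \<omega>\<bar>"
          moreover from this have "\<bar>B k \<omega>\<bar> * \<bar>R k \<omega>\<bar> \<le> K * (e / K)"
            using K(1) by (intro mult_mono) auto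
          ultimately show False using K(1) by (simp add: abs_mult)
        qed
      qed auto
      then show ?case using elim by linarith
    qed
  qed (auto intro!: always_eventually less_le_trans[OF _ measure_nonneg])
  then show ?thesis by (simp add: vanishes_in_prob_def)
qed

lemma vanishes_in_prob_mult_tendsto:
  assumes R: "vanishes_in_prob R" and [measurable]: "\<And>k. A k \<in> borel_measurable M"
    and lim: "AE \<omega> in M. (\<lambda>k. A k \<omega>) \<longlonglongrightarrow> a"
  shows "vanishes_in_prob (\<lambda>k \<omega>. A k \<omega> * R k \<omega>)"
proof (rule vanishes_in_prob_mult[OF R])
  fix d :: real assume "d > 0"
  have "vanishes_in_prob (\<lambda>k \<omega>. A k \<omega> - a)"
    by (rule vanishes_in_prob_AE) (use lim in \<open>auto simp: LIM_zero_iff\<close>)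
  then have "eventually (\<lambda>k. prob {\<omega> \<in> space M. \<bar>A k \<omega> - a\<bar> > 1} < d) sequentially"
    using \<open>d > 0\<close> unfolding vanishes_in_prob_def by (intro order_tendstoD(2)) auto
  then have "eventually (\<lambda>k. prob {\<omega> \<in> space M. \<bar>A k \<omega>\<bar> > \<bar>a\<bar> + 1} \<le> d) sequentially"
  proof eventually_elim
    case (elim k)
    have "prob {\<omega> \<in> space M. \<bar>A k \<omega>\<bar> > \<bar>a\<bar> + 1} \<le> prob {\<omega> \<in> space M. \<bar>A k \<omega> - a\<bar> > 1}"
      by (rule finite_measure_mono) auto
    then show ?case using elim by simp
  qed
  then show "\<exists>K>0. eventually (\<lambda>k. prob {\<omega> \<in> space M. \<bar>A k \<omega>\<bar> > K} \<le> d) sequentially"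
    by (intro exI[of _ "\<bar>a\<bar> + 1"]) auto
qed simp

text \<open>Slutsky's lemma for characteristic functions: x -> exp(itx) is |t|-Lipschitz, which is
  used where |U - V| \<le> e; elsewhere two numbers of modulus 1 differ by at most 2.\<close>

lemma char_tendsto_if_vanishes_in_prob:
  assumes [measurable]: "\<And>k. U k \<in> borel_measurable M" "\<And>k. V k \<in> borel_measurable M"
    and R: "vanishes_in_prob (\<lambda>k \<omega>. U k \<omega> - V k \<omega>)"
    and lim: "(\<lambda>k. char (distr M borel (V k)) t) \<longlonglongrightarrow> z"
  shows "(\<lambda>k. char (distr M borel (U k)) t) \<longlonglongrightarrow> z"
proof -
  have le: "norm (char (distr M borel (U k)) t - char (distr M borel (V k)) t) \<le>
      \<bar>t\<bar> * e + 2 * prob {\<omega> \<in> space M. \<bar>U k \<omega> - V k \<omega>\<bar> > e}" if "e > 0" for e k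
  proof -
    let ?D = "{\<omega> \<in> space M. \<bar>U k \<omega> - V k \<omega>\<bar> > e}"
    have D: "?D \<in> sets M" by measurable
    have ind: "integrable M (indicator ?D :: 'a \<Rightarrow> real)"
      using D by (simp add: less_top[symmetric])
    have "char (distr M borel (U k)) t - char (distr M borel (V k)) t =
        (CLINT \<omega>|M. iexp (t * U k \<omega>) - iexp (t * V k \<omega>))"
      by (subst Bochner_Integration.integral_diff)
         (auto simp: char_def integral_distr intro!: integrable_iexp)
    also have "norm \<dots> \<le> expectation (\<lambda>\<omega>. norm (iexp (t * U k \<omega>) - iexp (t * V k \<omega>)))"
      by (rule integral_norm_bound)
    also have "\<dots> \<le> expectation (\<lambda>\<omega>. \<bar>t\<bar> * e + 2 * indicator ?D \<omega>)"
    proof (rule integral_mono)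
      fix \<omega> assume \<omega>: "\<omega> \<in> space M"
      show "norm (iexp (t * U k \<omega>) - iexp (t * V k \<omega>)) \<le> \<bar>t\<bar> * e + 2 * indicator ?D \<omega>"
      proof (cases "\<omega> \<in> ?D")
        case True
        have "norm (iexp (t * U k \<omega>) - iexp (t * V k \<omega>)) \<le> 2"
          by (rule order_trans[OF norm_triangle_ineq4]) (simp add: norm_exp_i_times)
        also have "\<dots> \<le> \<bar>t\<bar> * e + 2 * indicator ?D \<omega>" using True \<open>e > 0\<close> by simp
        finally show ?thesis .
      next
        case False
        have "iexp (t * U k \<omega>) - iexp (t * V k \<omega>) = iexp (t * V k \<omega>) * (iexp (t * (U k \<omega> - V k \<omega>)) - 1)"
          by (simp add: ring_distribs flip: exp_add)
        then have "norm (iexp (t * U k \<omega>) - iexp (t * V k \<omega>)) = norm (iexp (t * (U k \<omega> - V k \<omega>)) - 1)"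
          by (simp add: norm_mult)
        also have "\<dots> \<le> \<bar>t * (U k \<omega> - V k \<omega>)\<bar>"
          using iexp_approx1[of "t * (U k \<omega> - V k \<omega>)" 0] by simp
        also have "\<dots> \<le> \<bar>t\<bar> * e"
          unfolding abs_mult using False \<omega> by (intro mult_left_mono) auto
        finally show ?thesis using False by simp
      qed
    qed (auto intro!: integrable_norm Bochner_Integration.integrable_diff integrable_iexp
        Bochner_Integration.integrable_add integrable_mult_right ind)
    also have "\<dots> = \<bar>t\<bar> * e + 2 * prob ?D" using ind D by (simp add: prob_space)
    finally show ?thesis .
  qed
  have "(\<lambda>k. char (distr M borel (U k)) t - char (distr M borel (V k)) t) \<longlonglongrightarrow> 0"
  proof (rule tendsto_norm_zero_cancel, rule order_tendstoI)
    fix d :: real assume "d > 0"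
    \<comment> \<open>The Lipschitz part costs at most d / 2 and the exceptional set less than 2 (d
      / 4); the summand 1 covers t = 0.\<close>
    define e where "e = d / (2 * (\<bar>t\<bar> + 1))"
    have e: "e > 0" "\<bar>t\<bar> * e \<le> d / 2" using \<open>d > 0\<close> by (auto simp: e_def field_simps)
    have "eventually (\<lambda>k. prob {\<omega> \<in> space M. \<bar>U k \<omega> - V k \<omega>\<bar> > e} < d / 4) sequentially"
      using R e \<open>d > 0\<close> unfolding vanishes_in_prob_def by (intro order_tendstoD(2)) auto
    then show "eventually (\<lambda>k. norm (char (distr M borel (U k)) t - char (distr M borel (V k)) t) < d) sequentially"
    proof eventually_elim
      case (elim k)
      then show ?case using le[OF e(1), of k] e(2) \<open>d > 0\<close> by linarith
    qed
  qed (auto intro!: always_eventually less_le_trans[OF _ norm_ge_zero])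
  from tendsto_add[OF this lim] show ?thesis by simp
qed

end

lemma sum_lessThan_add: "(\<Sum>i<a + m. g i) = (\<Sum>i<a. g i) + (\<Sum>i<m. g (a + i :: nat) :: real)"
  by (induction m) (auto simp: add.assoc)

context prob_space
begin

lemma measurable_random_sum:
  fixes Z :: "nat \<Rightarrow> 'a \<Rightarrow> real"
  assumes [measurable]: "\<And>i. Z i \<in> borel_measurable M" and \<nu>: "\<nu> \<in> measurable M (count_space UNIV)"
  shows "(\<lambda>\<omega>. \<Sum>i<\<nu> \<omega>. Z i \<omega>) \<in> borel_measurable M"
  by (rule measurable_compose_countable[OF _ \<nu>, where f = "\<lambda>n \<omega>. \<Sum>i<n. Z i \<omega>"]) simp

text \<open>If \<open>\<nu> k / N k\<close> is within \<open>\<delta>\<close> of \<open>q\<close>, both sums end in a window of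
  length about \<open>2 \<delta> N k\<close>, on which Kolmogorov's maximal inequality applies.\<close>

theorem Anscombe:
  fixes Z :: "nat \<Rightarrow> 'a \<Rightarrow> real" and \<nu> :: "nat \<Rightarrow> 'a \<Rightarrow> nat" and N :: "nat \<Rightarrow> real"
  assumes indep: "indep_vars (\<lambda>_. borel) Z UNIV"
    and sq: "\<And>i. integrable M (\<lambda>\<omega>. (Z i \<omega>)\<^sup>2)"
    and mean: "\<And>i. expectation (Z i) = 0"
    and var: "\<And>i. expectation (\<lambda>\<omega>. (Z i \<omega>)\<^sup>2) \<le> v"
    and \<nu>: "\<And>k. \<nu> k \<in> measurable M (count_space UNIV)"
    and N: "filterlim N at_top sequentially"
    and \<nu>_lim: "AE \<omega> in M. (\<lambda>k. real (\<nu> k \<omega>) / N k) \<longlonglongrightarrow> q"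
    and n_lim: "(\<lambda>k. real (n k) / N k) \<longlonglongrightarrow> q"
  shows "vanishes_in_prob (\<lambda>k \<omega>. ((\<Sum>i<\<nu> k \<omega>. Z i \<omega>) - (\<Sum>i<n k. Z i \<omega>)) / sqrt (N k))"
proof -
  have [measurable]: "Z i \<in> borel_measurable M" for i
    using indep by (auto simp: indep_vars_def)
  note \<nu>[measurable]
  have [measurable]: "(\<lambda>\<omega>. \<Sum>i<\<nu> k \<omega>. Z i \<omega>) \<in> borel_measurable M" for k
    by (rule measurable_random_sum) measurable
  have "v \<ge> 0" using var[of 0] by (rule order_trans[rotated]) simp
  have N_pos: "eventually (\<lambda>k. N k > 0) sequentially"
    using N by (rule filterlim_at_top_dense[THEN iffD1, rule_format])
  have "q \<ge> 0"
    by (rule tendsto_lowerbound[OF n_lim]) (use N_pos in \<open>auto elim: eventually_mono\<close>)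
  have "(\<lambda>k. prob {\<omega> \<in> space M. \<bar>((\<Sum>i<\<nu> k \<omega>. Z i \<omega>) - (\<Sum>i<n k. Z i \<omega>)) / sqrt (N k)\<bar> > e}) \<longlonglongrightarrow> 0"
    if "e > 0" for e
  proof (rule order_tendstoI)
    fix d :: real assume "d > 0"
    \<comment> \<open>The maximal inequality will yield \<open>8 v \<delta> / e\<^sup>2\<close> plus
      a term of order 1 / N. This \<delta> makes the first at most d / 2, with v + 1 in place of v
      to avoid dividing by zero; the second term and \<open>?far\<close> get d / 4 each.\<close>
    define \<delta> where "\<delta> = d * e\<^sup>2 / (16 * (v + 1))"
    have \<delta>: "\<delta> > 0" using \<open>d > 0\<close> \<open>e > 0\<close> \<open>v \<ge> 0\<close> by (simp add: \<delta>_def)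
    have \<delta>_small: "8 * v / e\<^sup>2 * \<delta> \<le> d / 2"
    proof -
      have "8 * v / e\<^sup>2 * \<delta> = d / 2 * (v / (v + 1))"
        using \<open>e > 0\<close> \<open>v \<ge> 0\<close> by (simp add: \<delta>_def field_simps)
      also have "\<dots> \<le> d / 2 * 1"
        using \<open>d > 0\<close> \<open>v \<ge> 0\<close> by (intro mult_left_mono) auto
      finally show ?thesis by simp
    qed
    let ?far = "\<lambda>k. {\<omega> \<in> space M. \<bar>real (\<nu> k \<omega>) / N k - q\<bar> > \<delta>}"
    have "vanishes_in_prob (\<lambda>k \<omega>. real (\<nu> k \<omega>) / N k - q)"
      by (rule vanishes_in_prob_AE) (use \<nu>_lim in \<open>auto simp: LIM_zero_iff\<close>)
    then have far: "eventually (\<lambda>k. prob (?far k) < d / 4) sequentially"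
      using \<delta> \<open>d > 0\<close> by (intro order_tendstoD(2)[OF vanishes_in_probD]) auto
    have near: "eventually (\<lambda>k. \<bar>real (n k) / N k - q\<bar> < \<delta>) sequentially"
      using tendstoD[OF n_lim \<delta>] by (simp add: dist_real_def)
    have "(\<lambda>k. (8 * v / e\<^sup>2) / N k) \<longlonglongrightarrow> 0"
      by (rule real_tendsto_divide_at_top[OF tendsto_const N])
    then have "eventually (\<lambda>k. (8 * v / e\<^sup>2) / N k < d / 4) sequentially"
      using \<open>d > 0\<close> by (intro order_tendstoD(2)) auto
    then show "eventually (\<lambda>k. prob {\<omega> \<in> space M.
        \<bar>((\<Sum>i<\<nu> k \<omega>. Z i \<omega>) - (\<Sum>i<n k. Z i \<omega>)) / sqrt (N k)\<bar> > e} < d) sequentially"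
      using far near N_pos
    proof eventually_elim
      case (elim k)
      have Npos: "N k > 0" by fact
      \<comment> \<open>\<open>nat\<close> cuts the lower end off at 0 when q - \<delta> is
        negative, which still bounds every natural number from below. Rounding outwards lengthens
        the window by up to 2, the source of the term of order 1 / N.\<close>
      define a where "a = nat \<lfloor>(q - \<delta>) * N k\<rfloor>"
      define b where "b = nat \<lceil>(q + \<delta>) * N k\<rceil>"
      have window: "a \<le> m \<and> m \<le> b" if "\<bar>real m / N k - q\<bar> \<le> \<delta>" for m
      proof -
        have "(q - \<delta>) * N k \<le> real m" "real m \<le> (q + \<delta>) * N k"
          using that Npos by (auto simp: abs_le_iff field_simps)
        then show ?thesis unfolding a_def b_def by linarith
      qed
      have nab: "a \<le> n k" "n k \<le> b" using window[of "n k"] elim(3) by auto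
      have len: "real (b - a) \<le> 2 * \<delta> * N k + 2"
      proof -
        have "(q + \<delta>) * N k \<ge> 0" using \<open>q \<ge> 0\<close> \<delta> Npos by simp
        then have "real b \<le> (q + \<delta>) * N k + 1" unfolding b_def by linarith
        moreover have "real a \<ge> (q - \<delta>) * N k - 1" unfolding a_def by linarith
        ultimately show ?thesis using nab by (simp add: of_nat_diff algebra_simps)
      qed
      \<comment> \<open>Both sums are compared with the sum up to \<open>a\<close>, hence half of
        the tolerance for each.\<close>
      let ?max = "{\<omega> \<in> space M. \<exists>m\<le>b - a. e / 2 * sqrt (N k) \<le> \<bar>\<Sum>i<m. Z (a + i) \<omega>\<bar>}"
      have "prob {\<omega> \<in> space M. \<bar>((\<Sum>i<\<nu> k \<omega>. Z i \<omega>) - (\<Sum>i<n k. Z i \<omega>)) / sqrt (N k)\<bar> > e}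
          \<le> prob (?far k) + prob ?max"
      proof (rule order_trans[OF finite_measure_mono measure_Un_le])
        show "{\<omega> \<in> space M. \<bar>((\<Sum>i<\<nu> k \<omega>. Z i \<omega>) - (\<Sum>i<n k. Z i \<omega>)) / sqrt (N k)\<bar> > e} \<subseteq> ?far k \<union> ?max"
        proof (rule subsetI, rule ccontr)
          fix \<omega>
          assume gt: "\<omega> \<in> {\<omega> \<in> space M. \<bar>((\<Sum>i<\<nu> k \<omega>. Z i \<omega>) - (\<Sum>i<n k. Z i \<omega>)) / sqrt (N k)\<bar> > e}"
            and "\<omega> \<notin> ?far k \<union> ?max"
          then have "\<bar>real (\<nu> k \<omega>) / N k - q\<bar> \<le> \<delta>"
            and small: "\<And>m. m \<le> b - a \<Longrightarrow> \<bar>\<Sum>i<m. Z (a + i) \<omega>\<bar> < e / 2 * sqrt (N k)"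
            by (auto simp: not_le) (meson leD)
          then have "a \<le> \<nu> k \<omega>" "\<nu> k \<omega> \<le> b" using window by auto
          have *: "\<bar>(\<Sum>i<m. Z i \<omega>) - (\<Sum>i<a. Z i \<omega>)\<bar> < e / 2 * sqrt (N k)" if "a \<le> m" "m \<le> b" for m
            using small[of "m - a"] sum_lessThan_add[of "\<lambda>i. Z i \<omega>" a "m - a"] that by auto
          have "\<bar>(\<Sum>i<\<nu> k \<omega>. Z i \<omega>) - (\<Sum>i<n k. Z i \<omega>)\<bar> < e * sqrt (N k)"
            using *[OF \<open>a \<le> \<nu> k \<omega>\<close> \<open>\<nu> k \<omega> \<le> b\<close>] *[OF nab] by linarith
          then show False using gt Npos by (simp add: abs_divide pos_less_divide_eq)
        qed
      qed measurable
      also have "prob ?max \<le> (\<Sum>i<b - a. expectation (\<lambda>\<omega>. (Z (a + i) \<omega>)\<^sup>2)) / (e / 2 * sqrt (N k))\<^sup>2"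
      proof (rule Kolmogorov_maximal_inequality)
        show "indep_vars (\<lambda>_. borel) (\<lambda>i. Z (a + i)) {..<b - a}"
          by (rule indep_vars_reindex[OF indep]) auto
      qed (use sq mean \<open>e > 0\<close> Npos in auto)
      also have "\<dots> \<le> (\<Sum>i<b - a. v) / (e / 2 * sqrt (N k))\<^sup>2"
        using var by (intro divide_right_mono sum_mono) auto
      also have "\<dots> \<le> ((2 * \<delta> * N k + 2) * v) / (e / 2 * sqrt (N k))\<^sup>2"
        using len \<open>v \<ge> 0\<close> by (intro divide_right_mono) (auto intro: mult_right_mono)
      also have "\<dots> = 8 * v / e\<^sup>2 * \<delta> + (8 * v / e\<^sup>2) / N k"
        using Npos \<open>e > 0\<close> by (simp add: power_mult_distrib power_divide field_simps)
      finally show ?case using \<delta>_small elim(1,2) by linarith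
    qed
  qed (auto intro!: always_eventually less_le_trans[OF _ measure_nonneg])
  then show ?thesis by (simp add: vanishes_in_prob_def)
qed

lemma char_distr_scale:
  assumes [measurable]: "W \<in> borel_measurable M"
  shows "char (distr M borel (\<lambda>\<omega>. b * W \<omega>)) t = char (distr M borel W) (b * t)"
  by (simp add: char_def integral_distr mult_ac)

end

lemma char_normal:
  assumes "\<sigma> > 0"
  shows "char (density lborel (normal_density 0 \<sigma>)) t = exp (- (\<sigma> * t)\<^sup>2 / 2)"
proof -
  interpret std: prob_space std_normal_distribution
    by (rule prob_space_normal_density) simp
  have "distributed std_normal_distribution lborel (\<lambda>x. x) std_normal_density"
    by (simp add: distributed_def distr_id2)
  then have "distributed std_normal_distribution lborel (\<lambda>x. 0 + \<sigma> * x) (normal_density (0 + \<sigma> * 0) (\<bar>\<sigma>\<bar> * 1))"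
    using assms by (intro std.normal_density_affine) auto
  then have "distr std_normal_distribution lborel (\<lambda>x. \<sigma> * x) = density lborel (normal_density 0 \<sigma>)"
    using assms by (simp add: distributed_def)
  then have "char (density lborel (normal_density 0 \<sigma>)) t = char (distr std_normal_distribution borel (\<lambda>x. \<sigma> * x)) t"
    by (metis distr_cong sets_lborel)
  also have "\<dots> = char std_normal_distribution (\<sigma> * t)"
    by (subst std.char_distr_scale) (auto simp: distr_id2)
  finally show ?thesis by (simp add: char_std_normal_distribution)
qed

section \<open>The allocation rules\<close>

text \<open>Rule (b) is water filling: every stratum is topped up to the common level \<open>\<lambda>\<close>.
  The sorting in its definition only serves to locate \<open>\<lambda>\<close>.\<close>

lemma ruleb_alloc_water_level:
  assumes s: "\<And>i. i \<in> {1..I} \<Longrightarrow> s i \<ge> 0" and p: "\<And>i. i \<in> {1..I} \<Longrightarrow> p i > 0"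
    and L: "L \<ge> 0" and ex: "\<exists>i\<in>{1..I}. s i \<noteq> 0"
  shows "\<exists>lam. (\<forall>i\<in>{1..I}. ruleb_alloc I p s Nprev L i = max 0 (p i * s i * lam - (real (Nprev i) + 1))) \<and>
    (\<Sum>i=1..I. ruleb_alloc I p s Nprev L i) = L"
proof -
  define J where "J = filter (\<lambda>i. s i \<noteq> 0) [1..<Suc I]"
  define n where "n = (\<lambda>i. real (Nprev i) + 1)"
  define \<alpha> where "\<alpha> = (\<lambda>i. p i * s i)"
  define ord where "ord = sort_key (\<lambda>i. - (n i / \<alpha> i)) J"
  define q where "q = length J"
  define lam where "lam = (\<lambda>t. (L + (\<Sum>j\<in>set (drop t ord). n j)) / (\<Sum>j\<in>set (drop t ord). \<alpha> j))"
  define C where "C = {t\<in>{1..q-1}. n (ord ! (t-1)) / \<alpha> (ord ! (t-1)) \<ge> lam t}"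
  define istar where "istar = (if C = {} then 0 else Max C)"
  have ruleb: "ruleb_alloc I p s Nprev L = (\<lambda>i. if i \<in> set (drop istar ord) then \<alpha> i * lam istar - n i else 0)"
    unfolding ruleb_alloc_def Let_def istar_def C_def lam_def q_def ord_def \<alpha>_def n_def J_def ..
  have set_J: "set J = {i\<in>{1..I}. s i \<noteq> 0}" by (auto simp: J_def)
  have set_ord: "set ord = set J" by (simp add: ord_def)
  have dist: "distinct ord" by (simp add: ord_def J_def)
  have len: "length ord = q" by (simp add: ord_def q_def)
  have \<alpha>_pos: "\<alpha> i > 0" if "i \<in> set ord" for i
    using that s[of i] p[of i] unfolding set_ord set_J \<alpha>_def by (auto simp: order_le_less)
  have "set ord \<noteq> {}" using ex unfolding set_ord set_J by auto
  then have "q > 0" using len by auto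
  have "sorted (map (\<lambda>i. - (n i / \<alpha> i)) ord)" by (simp add: ord_def)
  then have mono: "n (ord ! b) / \<alpha> (ord ! b) \<le> n (ord ! a) / \<alpha> (ord ! a)" if "a \<le> b" "b < q" for a b
    using that len by (auto dest: sorted_nth_mono[of _ a b])
  have "finite C" by (simp add: C_def)
  then have istar_in: "istar \<in> C" if "istar \<noteq> 0"
    using that Max_in[of C] unfolding istar_def by (auto split: if_splits)
  then have istar_less: "istar < q" using \<open>q > 0\<close> by (cases "istar = 0") (auto simp: C_def)
  have notin_C: "t \<notin> C" if "t > istar" for t
    using that Max_ge[OF \<open>finite C\<close>, of t] unfolding istar_def by (auto split: if_splits)
  have split: "set (drop t ord) = insert (ord ! t) (set (drop (Suc t) ord))"
      "ord ! t \<notin> set (drop (Suc t) ord)" if "t < q" for t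
    using that len dist distinct_drop[OF dist, of t] by (auto simp flip: Cons_nth_drop_Suc)
  have sum_pos: "(\<Sum>j\<in>set (drop t ord). \<alpha> j) > 0" if "t < q" for t
    using that len by (intro sum_pos \<alpha>_pos) (auto dest: in_set_dropD)
  have lam_eq: "lam t * (\<Sum>j\<in>set (drop t ord). \<alpha> j) = L + (\<Sum>j\<in>set (drop t ord). n j)" if "t < q" for t
    using sum_pos[OF that] by (simp add: lam_def)
  \<comment> \<open>List positions start at 0, so the first retained stratum
    \<open>ord ! istar\<close> belongs to the candidate \<open>Suc istar\<close>, whose test fails
    by maximality. As \<open>lam istar\<close> is the mediant of the ratio n / \<alpha> of this
    stratum and \<open>lam (Suc istar)\<close>, it lies above that ratio. The last position is never
    a candidate; there L \<ge> 0 gives the claim.\<close>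
  have above: "n (ord ! istar) / \<alpha> (ord ! istar) \<le> lam istar"
  proof -
    let ?i = "ord ! istar"
    define A where "A = (\<Sum>j\<in>set (drop (Suc istar) ord). \<alpha> j)"
    have "?i \<in> set ord" using istar_less len by simp
    then have a: "\<alpha> ?i > 0" by (rule \<alpha>_pos)
    have sums: "(\<Sum>j\<in>set (drop istar ord). \<alpha> j) = \<alpha> ?i + A"
        "(\<Sum>j\<in>set (drop istar ord). n j) = n ?i + (\<Sum>j\<in>set (drop (Suc istar) ord). n j)"
      using split(2)[OF istar_less] unfolding A_def split(1)[OF istar_less] by auto
    show ?thesis
    proof (cases "Suc istar < q")
      case True
      then have "n ?i / \<alpha> ?i < lam (Suc istar)"
        using notin_C[of "Suc istar"] by (auto simp: C_def)
      then have "n ?i \<le> lam (Suc istar) * \<alpha> ?i" using a by (simp add: field_simps)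
      moreover have "A > 0" unfolding A_def by (rule sum_pos) (use True in auto)
      ultimately have "n ?i * A \<le> lam (Suc istar) * \<alpha> ?i * A" by (simp add: mult_right_mono)
      also have "\<dots> = \<alpha> ?i * (L + (\<Sum>j\<in>set (drop (Suc istar) ord). n j))"
        using lam_eq[OF True] by (simp add: A_def)
      finally have "n ?i * (\<alpha> ?i + A) \<le> \<alpha> ?i * (L + (\<Sum>j\<in>set (drop istar ord). n j))"
        unfolding sums by (simp add: algebra_simps)
      then show ?thesis using a \<open>A > 0\<close> unfolding lam_def sums by (simp add: field_simps)
    next
      case False
      then have "set (drop (Suc istar) ord) = {}" using len by simp
      then show ?thesis using L a unfolding lam_def sums A_def by (simp add: field_simps)
    qed
  qed
  have low: "n i \<le> \<alpha> i * lam istar" if i: "i \<in> set (drop istar ord)" for i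
  proof -
    obtain b where "b < length (drop istar ord)" "i = drop istar ord ! b"
      using i unfolding in_set_conv_nth by metis
    then have b: "istar + b < q" "i = ord ! (istar + b)" using len by auto
    have "n i / \<alpha> i \<le> lam istar" using mono[of istar "istar + b"] above b by simp
    then show ?thesis using \<alpha>_pos[OF in_set_dropD[OF i]] by (simp add: field_simps)
  qed
  \<comment> \<open>The ratios are nonincreasing along \<open>ord\<close>, so a dropped stratum has
    at least the ratio at position \<open>istar - 1\<close>, and that one passed its test against
    \<open>lam istar\<close> itself.\<close>
  have high: "\<alpha> i * lam istar \<le> n i" if i: "i \<in> set ord" "i \<notin> set (drop istar ord)" for i
  proof -
    have "i \<in> set (take istar ord)"
      using i by (metis append_take_drop_id Un_iff set_append)
    then obtain b where b: "b < istar" "i = ord ! b"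
      unfolding in_set_conv_nth by auto
    then have "istar \<in> C" using istar_in by simp
    then have "lam istar \<le> n (ord ! (istar - 1)) / \<alpha> (ord ! (istar - 1))" by (simp add: C_def)
    also have "\<dots> \<le> n i / \<alpha> i" unfolding b(2) by (rule mono) (use b istar_less in auto)
    finally show ?thesis using \<alpha>_pos[OF i(1)] by (simp add: field_simps)
  qed
  have "ruleb_alloc I p s Nprev L i = max 0 (\<alpha> i * lam istar - n i)" if "i \<in> {1..I}" for i
  proof (cases "i \<in> set ord")
    case True
    then show ?thesis using low[of i] high[of i] unfolding ruleb
      by (cases "i \<in> set (drop istar ord)") simp_all
  next
    case False
    \<comment> \<open>A stratum with zero standard deviation is absent from the list, and the
      formula agrees: its maximum is 0 because \<alpha> vanishes and n \<ge> 0.\<close>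
    then have "\<alpha> i = 0" "n i \<ge> 0" using that unfolding set_ord set_J \<alpha>_def n_def by auto
    then show ?thesis using False unfolding ruleb by (auto simp: max_def dest: in_set_dropD)
  qed
  moreover have "(\<Sum>i=1..I. ruleb_alloc I p s Nprev L i) = L"
  proof -
    have sub: "set (drop istar ord) \<subseteq> {1..I}"
      using set_drop_subset[of istar ord] unfolding set_ord set_J by auto
    have "(\<Sum>i=1..I. ruleb_alloc I p s Nprev L i) = (\<Sum>i\<in>set (drop istar ord). \<alpha> i * lam istar - n i)"
      unfolding ruleb using sub by (simp add: sum.inter_restrict[symmetric] Int_absorb1)
    also have "\<dots> = L" using lam_eq[OF istar_less]
      by (simp add: sum_subtractf sum_distrib_left mult.commute)
    finally show ?thesis .
  qed
  ultimately show ?thesis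
    by (intro exI[of _ "lam istar"]) (auto simp: \<alpha>_def n_def)
qed

text \<open>\<open>sqrt\<close> is an odd function on the reals, so the sign is not automatic: the
  radicand is nonnegative by Cauchy-Schwarz, and for n = 0 division by zero makes it 0.\<close>

lemma emp_sd_nonneg: "emp_sd y i n \<ge> 0"
proof -
  have "(\<Sum>j=1..n. y i j)\<^sup>2 \<le> (\<Sum>j=1..n. (y i j)\<^sup>2) * real n"
    using sum_squared_le_sum_of_squares[of "y i" "{1..n}"] by (simp add: mult.commute)
  then have "(\<Sum>j=1..n. y i j)\<^sup>2 / real n \<le> (\<Sum>j=1..n. (y i j)\<^sup>2)"
    by (cases "n = 0") (simp_all add: pos_divide_le_eq sum_nonneg)
  then have "((\<Sum>j=1..n. y i j)\<^sup>2 / real n) / real n \<le> (\<Sum>j=1..n. (y i j)\<^sup>2) / real n"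
    by (rule divide_right_mono) simp
  then have "((\<Sum>j=1..n. y i j) / real n)\<^sup>2 \<le> (\<Sum>j=1..n. (y i j)\<^sup>2) / real n"
    by (simp add: power_divide power2_eq_square)
  then show ?thesis by (simp add: emp_sd_def)
qed

text \<open>What systematic sampling relies on: nonnegative shares give nonnegative rounded counts,
  and the exact total L keeps the rounding from losing a draw.\<close>

lemma sum_alloc_m_all_strata:
  assumes s: "\<And>i. i \<in> {1..I} \<Longrightarrow> s i \<ge> 0" and p: "\<And>i. i \<in> {1..I} \<Longrightarrow> p i > 0"
    and p_sum: "(\<Sum>i=1..I. p i) = 1" and L: "L \<ge> 0"
  shows "(\<Sum>i=1..I. alloc_m rule I p s Nprev L i) = L"
    and "i \<in> {1..I} \<Longrightarrow> alloc_m rule I p s Nprev L i \<ge> 0"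
proof -
  have ps: "(\<Sum>j=1..I. p j * s j) > 0" if ex: "\<exists>i\<in>{1..I}. s i \<noteq> 0"
  proof -
    from ex obtain j where j: "j \<in> {1..I}" "s j \<noteq> 0" by auto
    then have "p j * s j > 0" using s[of j] p[of j] by simp
    moreover have "p i * s i \<ge> 0" if "i \<in> {1..I}" for i
      using s[OF that] p[OF that] by simp
    ultimately show ?thesis using j(1) by (intro sum_pos2[of _ j]) auto
  qed
  have "(\<Sum>i=1..I. alloc_m rule I p s Nprev L i) = L \<and>
    (\<forall>i\<in>{1..I}. alloc_m rule I p s Nprev L i \<ge> 0)"
  proof (cases "\<forall>i\<in>{1..I}. s i = 0")
    case True
    then show ?thesis using p_sum L p
      by (auto simp: alloc_m_def sum_distrib_right[symmetric] less_imp_le)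
  next
    case False
    then have ex: "\<exists>i\<in>{1..I}. s i \<noteq> 0" by simp
    show ?thesis
    proof (cases rule)
      case RuleA
      have "alloc_m rule I p s Nprev L = (\<lambda>i. p i * s i / (\<Sum>j=1..I. p j * s j) * L)"
        unfolding alloc_m_def if_not_P[OF False] RuleA by simp
      then show ?thesis using ps[OF ex] L p s
        by (auto simp: sum_distrib_right[symmetric] sum_divide_distrib[symmetric] less_imp_le)
    next
      case RuleB
      have "alloc_m rule I p s Nprev L = ruleb_alloc I p s Nprev L"
        unfolding alloc_m_def if_not_P[OF False] RuleB by simp
      moreover obtain lam where
        "\<And>i. i \<in> {1..I} \<Longrightarrow> ruleb_alloc I p s Nprev L i = max 0 (p i * s i * lam - (real (Nprev i) + 1))"
        "(\<Sum>i=1..I. ruleb_alloc I p s Nprev L i) = L"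
        using ruleb_alloc_water_level[where I = I and s = s and p = p and Nprev = Nprev, OF s p L ex] by blast
      ultimately show ?thesis by simp
    qed
  qed
  then show "(\<Sum>i=1..I. alloc_m rule I p s Nprev L i) = L"
    "i \<in> {1..I} \<Longrightarrow> alloc_m rule I p s Nprev L i \<ge> 0" by auto
qed

text \<open>Rule (a) attains the second branch. Under rule (b) every size before rounding is at
  least \<open>p i * s i * lam\<close>, and summing bounds \<open>lam\<close> by the total size over
  the total weight. A stratum filled to the level then obeys the first branch, one that was above it
  the second.\<close>

lemma alloc_m_le:
  assumes s: "\<And>i. i \<in> {1..I} \<Longrightarrow> s i \<ge> 0" and p: "\<And>i. i \<in> {1..I} \<Longrightarrow> p i > 0"
    and L: "L \<ge> 0" and ps: "(\<Sum>j=1..I. p j * s j) > 0" and i: "i \<in> {1..I}"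
  defines "r \<equiv> p i * s i / (\<Sum>j=1..I. p j * s j)"
  shows "real (Nprev i) + 1 + alloc_m rule I p s Nprev L i
      \<le> max (r * (L + (\<Sum>j=1..I. real (Nprev j) + 1))) (real (Nprev i) + 1 + r * L)"
proof -
  have ex: "\<not> (\<forall>i\<in>{1..I}. s i = 0)"
  proof
    assume "\<forall>i\<in>{1..I}. s i = 0"
    then have "(\<Sum>j=1..I. p j * s j) = 0" by (intro sum.neutral) auto
    then show False using ps by simp
  qed
  have "r \<ge> 0" using s[OF i] p[OF i] ps by (auto simp: r_def)
  show ?thesis
  proof (cases rule)
    case RuleA
    then show ?thesis unfolding alloc_m_def if_not_P[OF ex] by (simp add: r_def)
  next
    case RuleB
    have ex': "\<exists>i\<in>{1..I}. s i \<noteq> 0" using ex by auto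
    obtain lam where lam:
      "\<And>i. i \<in> {1..I} \<Longrightarrow> ruleb_alloc I p s Nprev L i = max 0 (p i * s i * lam - (real (Nprev i) + 1))"
      "(\<Sum>i=1..I. ruleb_alloc I p s Nprev L i) = L"
      using ruleb_alloc_water_level[where I = I and s = s and p = p and Nprev = Nprev, OF s p L ex'] by blast
    have "(\<Sum>j=1..I. p j * s j) * lam \<le> (\<Sum>j=1..I. real (Nprev j) + 1 + ruleb_alloc I p s Nprev L j)"
      unfolding sum_distrib_right by (rule sum_mono) (simp add: lam(1))
    also have "\<dots> = L + (\<Sum>j=1..I. real (Nprev j) + 1)"
      using lam(2) by (simp add: sum.distrib)
    finally have "lam \<le> (L + (\<Sum>j=1..I. real (Nprev j) + 1)) / (\<Sum>j=1..I. p j * s j)"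
      using ps by (simp add: field_simps)
    then have "p i * s i * lam \<le> p i * s i * ((L + (\<Sum>j=1..I. real (Nprev j) + 1)) / (\<Sum>j=1..I. p j * s j))"
      by (rule mult_left_mono) (use s[OF i] p[OF i] in auto)
    then have "p i * s i * lam \<le> r * (L + (\<Sum>j=1..I. real (Nprev j) + 1))"
      by (simp add: r_def)
    moreover have "r * L \<ge> 0" using \<open>r \<ge> 0\<close> L by simp
    ultimately show ?thesis
      using lam(1)[OF i] unfolding alloc_m_def if_not_P[OF ex] RuleB by (simp add: max_def)
  qed
qed

lemma sum_sys_round: "(\<Sum>i=1..I. sys_round m i) = \<lfloor>\<Sum>i=1..I. m i\<rfloor>"
  by (induction I) (auto simp: sys_round_def)

lemma sys_round_bounds:
  assumes "i \<ge> 1" "m i \<ge> 0"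
  shows "sys_round m i \<ge> 0" "real_of_int (sys_round m i) \<le> m i + 1"
proof -
  obtain k where k: "i = Suc k" using assms(1) by (cases i) auto
  show "sys_round m i \<ge> 0"
    using assms(2) by (auto simp: sys_round_def k intro: floor_mono)
  show "real_of_int (sys_round m i) \<le> m i + 1"
    unfolding sys_round_def k by simp linarith
qed

section \<open>The recursion for the sample sizes, for a fixed array of values\<close>

locale allocation =
  fixes rule :: alloc_rule and I :: nat and p :: "nat \<Rightarrow> real" and Nseq :: "nat \<Rightarrow> nat"
  assumes p_pos: "i \<in> {1..I} \<Longrightarrow> p i > 0"
    and p_sum: "(\<Sum>i=1..I. p i) = 1"
    and N0: "Nseq 0 = 0"
    and N_incr: "Nseq k + I \<le> Nseq (Suc k)"
begin

definition step_sd :: "(nat \<Rightarrow> nat \<Rightarrow> real) \<Rightarrow> nat \<Rightarrow> nat \<Rightarrow> real" where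
  "step_sd y k i = (if k = 0 then 1 else emp_sd y i (alloc_N rule I p Nseq y k i))"

definition step_m :: "(nat \<Rightarrow> nat \<Rightarrow> real) \<Rightarrow> nat \<Rightarrow> nat \<Rightarrow> real" where
  "step_m y k = alloc_m rule I p (step_sd y k) (alloc_N rule I p Nseq y k)
     (real (Nseq (Suc k)) - real (Nseq k) - real I)"

lemma alloc_N_Suc:
  "alloc_N rule I p Nseq y (Suc k) i =
     alloc_N rule I p Nseq y k i + 1 + nat (sys_round (step_m y k) i)"
  unfolding step_m_def step_sd_def by (simp add: Let_def if_distrib[of "\<lambda>f. f _"] cong: if_cong)

declare alloc_N.simps(2) [simp del]

lemma L_nonneg: "real (Nseq (Suc k)) - real (Nseq k) - real I \<ge> 0"
  using of_nat_mono[OF N_incr[of k], where 'a = real] by simp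

lemma step_sd_nonneg: "step_sd y k i \<ge> 0"
  by (simp add: step_sd_def emp_sd_nonneg)

lemma sum_step_m: "(\<Sum>i=1..I. step_m y k i) = real (Nseq (Suc k)) - real (Nseq k) - real I"
  unfolding step_m_def
  by (rule sum_alloc_m_all_strata(1)[OF step_sd_nonneg p_pos p_sum L_nonneg])

lemma step_m_nonneg: "i \<in> {1..I} \<Longrightarrow> step_m y k i \<ge> 0"
  unfolding step_m_def
  by (rule sum_alloc_m_all_strata(2)[OF step_sd_nonneg p_pos p_sum L_nonneg])

lemma sum_alloc_N: "(\<Sum>i=1..I. alloc_N rule I p Nseq y k i) = Nseq k"
proof (induction k)
  case (Suc k)
  have "int (\<Sum>i=1..I. nat (sys_round (step_m y k) i)) = (\<Sum>i=1..I. sys_round (step_m y k) i)"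
    unfolding of_nat_sum by (rule sum.cong) (auto simp: sys_round_bounds step_m_nonneg)
  \<comment> \<open>The differences of floors telescope, and the total being an integer, the last
    floor loses nothing.\<close>
  also have "\<dots> = \<lfloor>real (Nseq (Suc k)) - real (Nseq k) - real I\<rfloor>"
    by (simp only: sum_sys_round sum_step_m)
  also have "\<dots> = int (Nseq (Suc k)) - int (Nseq k) - int I"
    by (simp add: floor_eq_iff)
  finally have "int (\<Sum>i=1..I. nat (sys_round (step_m y k) i)) = int (Nseq (Suc k)) - int (Nseq k) - int I" .
  then have "int (\<Sum>i=1..I. alloc_N rule I p Nseq y (Suc k) i) = int (Nseq (Suc k))"
    unfolding alloc_N_Suc sum.distrib Suc by simp
  then show ?case by linarith
qed (simp add: N0)

lemma alloc_N_ge: "k \<le> alloc_N rule I p Nseq y k i"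
  by (induction k) (auto simp: alloc_N_Suc)

lemma alloc_N_step_le:
  assumes i: "i \<in> {1..I}" and ps: "(\<Sum>j=1..I. p j * step_sd y k j) > 0"
  defines "r \<equiv> p i * step_sd y k i / (\<Sum>j=1..I. p j * step_sd y k j)"
  shows "real (alloc_N rule I p Nseq y (Suc k) i) \<le>
    max (r * real (Nseq (Suc k))) (real (alloc_N rule I p Nseq y k i) + r * (real (Nseq (Suc k)) - real (Nseq k))) + 2"
proof -
  let ?N = "alloc_N rule I p Nseq y k" and ?L = "real (Nseq (Suc k)) - real (Nseq k) - real I"
  have "r \<ge> 0" using step_sd_nonneg p_pos[OF i] ps by (auto simp: r_def)
  have "(\<Sum>j=1..I. real (?N j) + 1) = real (Nseq k) + real I"
    using sum_alloc_N[of y k] by (simp add: sum.distrib flip: of_nat_sum)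
  then have "real (?N i) + 1 + step_m y k i \<le> max (r * real (Nseq (Suc k))) (real (?N i) + 1 + r * ?L)"
    using alloc_m_le[OF step_sd_nonneg p_pos L_nonneg ps i, of ?N rule k]
    unfolding step_m_def r_def[symmetric] by (simp add: algebra_simps)
  moreover have "r * ?L \<le> r * (real (Nseq (Suc k)) - real (Nseq k))"
    using \<open>r \<ge> 0\<close> by (intro mult_left_mono) auto
  moreover have "real (alloc_N rule I p Nseq y (Suc k) i) \<le> real (?N i) + 1 + (step_m y k i + 1)"
    using sys_round_bounds[of i "step_m y k"] step_m_nonneg[OF i, of y k] i
    unfolding alloc_N_Suc by (simp add: of_nat_nat)
  ultimately show ?thesis by (simp add: max_def split: if_splits)
qed

end

section \<open>Convergence of the sampling proportions along a path\<close>

lemma limsup_ratio_le: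
  fixes x :: "nat \<Rightarrow> real" and N :: "nat \<Rightarrow> nat"
  assumes step: "\<And>k. k \<ge> K \<Longrightarrow>
      x (Suc k) \<le> max (c * real (N (Suc k))) (x k + c * (real (N (Suc k)) - real (N k))) + 2"
    and c: "c \<ge> 0" and x: "x K \<ge> 0" and kN: "(\<lambda>k. real k / real (N k)) \<longlonglongrightarrow> 0"
    and N: "\<And>k. k \<le> N k" and "e > 0"
  shows "eventually (\<lambda>k. x k / real (N k) \<le> c + e) sequentially"
proof -
  \<comment> \<open>In the first branch the bound is restored directly, using x K \<ge> 0; in the
    second the increments of c N telescope. Either way a step costs at most 2, and the accumulated
    2k is negligible against N k.\<close>
  have bound: "x k \<le> c * real (N k) + 2 * real k + x K" if "k \<ge> K" for k
    using that
  proof (induction k rule: dec_induct)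
    case base
    then show ?case using c by simp
  next
    case (step k)
    then show ?case using assms(1)[of k] x by (auto simp: algebra_simps max_def split: if_splits)
  qed
  have "(\<lambda>k. 2 * (real k / real (N k)) + x K / real (N k)) \<longlonglongrightarrow> 2 * 0 + 0"
  proof (intro tendsto_add tendsto_mult_left kN)
    have "filterlim (\<lambda>k. real (N k)) at_top sequentially"
      by (rule filterlim_at_top_mono[OF filterlim_real_sequentially]) (use N in auto)
    then show "(\<lambda>k. x K / real (N k)) \<longlonglongrightarrow> 0"
      by (intro real_tendsto_divide_at_top[OF tendsto_const])
  qed
  then have "eventually (\<lambda>k. 2 * (real k / real (N k)) + x K / real (N k) < e) sequentially"
    using \<open>e > 0\<close> by (intro order_tendstoD(2)) auto
  then show ?thesis
    using eventually_ge_at_top[of "max K 1"]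
  proof eventually_elim
    case (elim k)
    then have pos: "real (N k) > 0" using N[of k] by simp
    have "x k / real (N k) \<le> (c * real (N k) + 2 * real k + x K) / real (N k)"
      using bound[of k] elim by (intro divide_right_mono) auto
    also have "\<dots> = c + (2 * (real k / real (N k)) + x K / real (N k))"
      using pos by (simp add: add_divide_distrib)
    finally show ?case using elim by simp
  qed
qed

lemma tendsto_if_limsup_le:
  fixes x :: "nat \<Rightarrow> 'i \<Rightarrow> real"
  assumes fin: "finite S"
    and le: "\<And>i e. i \<in> S \<Longrightarrow> e > 0 \<Longrightarrow> eventually (\<lambda>k. x k i \<le> q i + e) sequentially"
    and sum: "eventually (\<lambda>k. (\<Sum>i\<in>S. x k i) = (\<Sum>i\<in>S. q i)) sequentially"
    and i: "i \<in> S"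
  shows "(\<lambda>k. x k i) \<longlonglongrightarrow> q i"
proof (rule tendstoI)
  fix e :: real assume "e > 0"
  \<comment> \<open>The deficit of one coordinate is at most the summed excess of the others, (card
    S - 1) d; the 1 in the denominator makes the final bound strict.\<close>
  define d where "d = e / (real (card S) + 1)"
  have d: "d > 0" "real (card S) * d < e" using \<open>e > 0\<close> by (auto simp: d_def field_simps)
  have "1 \<le> card S" using i fin by (metis card_gt_0_iff empty_iff Suc_le_eq One_nat_def)
  then have "d \<le> real (card S) * d" using d by simp
  have "eventually (\<lambda>k. \<forall>j\<in>S. x k j \<le> q j + d) sequentially"
    using le d(1) by (intro eventually_ball_finite fin) auto
  then show "eventually (\<lambda>k. dist (x k i) (q i) < e) sequentially"
    using sum
  proof eventually_elim
    case (elim k)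
    have "(\<Sum>j\<in>S - {i}. x k j) \<le> (\<Sum>j\<in>S - {i}. q j + d)"
      by (rule sum_mono) (use elim in auto)
    also have "\<dots> = (\<Sum>j\<in>S - {i}. q j) + real (card S - 1) * d"
      using i fin by (simp add: sum.distrib)
    also have "real (card S - 1) * d \<le> real (card S) * d"
      using d(1) by (intro mult_right_mono) auto
    finally have "q i - real (card S) * d \<le> x k i"
      using elim(2) by (simp add: sum.remove[OF fin i])
    moreover have "x k i \<le> q i + d" using elim(1) i by simp
    ultimately show ?case using d \<open>d \<le> real (card S) * d\<close>
      unfolding dist_real_def abs_less_iff by linarith
  qed
qed

context allocation
begin

lemma Nseq_ge: "I \<ge> 1 \<Longrightarrow> k \<le> Nseq k"
  using member_le_sum[of 1 "{1..I}" "alloc_N rule I p Nseq y k"] alloc_N_ge[of k y 1]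
  by (simp add: sum_alloc_N del: One_nat_def)

lemma alloc_ratio_tendsto:
  assumes sd: "\<And>i. i \<in> {1..I} \<Longrightarrow> emp_sd y i \<longlonglongrightarrow> \<sigma> i"
    and ps: "(\<Sum>j=1..I. p j * \<sigma> j) > 0"
    and kN: "(\<lambda>k. real k / real (Nseq k)) \<longlonglongrightarrow> 0"
    and i: "i \<in> {1..I}"
  shows "(\<lambda>k. real (alloc_N rule I p Nseq y k i) / real (Nseq k)) \<longlonglongrightarrow> p i * \<sigma> i / (\<Sum>j=1..I. p j * \<sigma> j)"
proof -
  have I: "I \<ge> 1" using i by simp
  \<comment> \<open>After k steps each stratum holds at least k draws, so convergence in the sample
    size becomes convergence in k. Only k = 0 carries the default value 1.\<close>
  have step_lim: "(\<lambda>k. step_sd y k j) \<longlonglongrightarrow> \<sigma> j" if j: "j \<in> {1..I}" for j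
  proof -
    have "filterlim (\<lambda>k. alloc_N rule I p Nseq y k j) at_top sequentially"
      by (rule filterlim_at_top_mono[OF filterlim_ident]) (simp add: alloc_N_ge)
    from filterlim_compose[OF sd[OF j] this]
    show ?thesis
      by (rule Lim_transform_eventually)
         (auto simp: step_sd_def eventually_sequentially intro!: exI[of _ 1])
  qed
  have sum_lim: "(\<lambda>k. \<Sum>j=1..I. p j * step_sd y k j) \<longlonglongrightarrow> (\<Sum>j=1..I. p j * \<sigma> j)"
    by (intro tendsto_sum tendsto_mult_left step_lim)
  have \<sigma>_nonneg: "\<sigma> j \<ge> 0" if "j \<in> {1..I}" for j
    by (rule LIMSEQ_le_const[OF step_lim[OF that]]) (auto simp: step_sd_nonneg)
  show ?thesis
  proof (rule tendsto_if_limsup_le[OF _ _ _ i])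
    show "eventually (\<lambda>k. (\<Sum>i=1..I. real (alloc_N rule I p Nseq y k i) / real (Nseq k)) =
        (\<Sum>i=1..I. p i * \<sigma> i / (\<Sum>j=1..I. p j * \<sigma> j))) sequentially"
      using eventually_gt_at_top[of 0]
    proof eventually_elim
      case (elim k)
      then show ?case
        using ps Nseq_ge[OF I, of k]
        by (simp add: sum_divide_distrib[symmetric] sum_alloc_N del: One_nat_def flip: of_nat_sum)
    qed
  next
    fix j and e :: real assume j: "j \<in> {1..I}" and "e > 0"
    define r where "r k = p j * step_sd y k j / (\<Sum>l=1..I. p l * step_sd y k l)" for k
    \<comment> \<open>Half of e lifts the slope above the limit of \<open>r\<close>, so that one
      constant slope serves from some step on; the other half absorbs the error terms of
      \<open>limsup_ratio_le\<close>.\<close>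
    define c where "c = p j * \<sigma> j / (\<Sum>l=1..I. p l * \<sigma> l) + e / 2"
    have c: "c \<ge> 0" using \<open>e > 0\<close> ps p_pos[OF j] \<sigma>_nonneg[OF j] by (simp add: c_def)
    have "r \<longlonglongrightarrow> p j * \<sigma> j / (\<Sum>l=1..I. p l * \<sigma> l)"
      unfolding r_def by (intro tendsto_divide tendsto_mult_left step_lim j sum_lim) (use ps in auto)
    then have "eventually (\<lambda>k. r k < c) sequentially"
      using \<open>e > 0\<close> by (intro order_tendstoD(2)) (auto simp: c_def)
    \<comment> \<open>From here on some estimated deviation is positive, so the fallback allocation
      proportional to p no longer occurs.\<close>
    moreover have "eventually (\<lambda>k. (\<Sum>l=1..I. p l * step_sd y k l) > 0) sequentially"
      by (rule order_tendstoD(1)[OF sum_lim ps])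
    ultimately have "eventually (\<lambda>k. r k < c \<and> (\<Sum>l=1..I. p l * step_sd y k l) > 0) sequentially"
      by eventually_elim simp
    then obtain K where K: "\<And>k. k \<ge> K \<Longrightarrow> r k < c" "\<And>k. k \<ge> K \<Longrightarrow> (\<Sum>l=1..I. p l * step_sd y k l) > 0"
      unfolding eventually_sequentially by auto
    have "eventually (\<lambda>k. real (alloc_N rule I p Nseq y k j) / real (Nseq k) \<le> c + e / 2) sequentially"
    proof (rule limsup_ratio_le[where K = K])
      fix k assume k: "k \<ge> K"
      have "real (alloc_N rule I p Nseq y (Suc k) j) \<le> max (r k * real (Nseq (Suc k)))
          (real (alloc_N rule I p Nseq y k j) + r k * (real (Nseq (Suc k)) - real (Nseq k))) + 2"
        unfolding r_def by (rule alloc_N_step_le[OF j K(2)[OF k]])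
      also have "\<dots> \<le> max (c * real (Nseq (Suc k)))
          (real (alloc_N rule I p Nseq y k j) + c * (real (Nseq (Suc k)) - real (Nseq k))) + 2"
        using K(1)[OF k] L_nonneg[of k] by (intro add_mono max.mono mult_right_mono) auto
      finally show "real (alloc_N rule I p Nseq y (Suc k) j) \<le> max (c * real (Nseq (Suc k)))
          (real (alloc_N rule I p Nseq y k j) + c * (real (Nseq (Suc k)) - real (Nseq k))) + 2" .
    qed (use c kN Nseq_ge[OF I] \<open>e > 0\<close> in auto)
    then show "eventually (\<lambda>k. real (alloc_N rule I p Nseq y k j) / real (Nseq k)
        \<le> p j * \<sigma> j / (\<Sum>l=1..I. p l * \<sigma> l) + e) sequentially"
      by (simp add: c_def add.assoc)
  qed simp
qed

end

section \<open>Measurability of the sample sizes\<close>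

lemma measurable_water_level:
  fixes \<alpha> n :: "'i \<Rightarrow> 'w \<Rightarrow> real"
  assumes fin: "finite S"
    and [measurable]: "\<And>i. i \<in> S \<Longrightarrow> \<alpha> i \<in> borel_measurable M" "\<And>i. i \<in> S \<Longrightarrow> n i \<in> borel_measurable M"
    and \<alpha>: "\<And>i \<omega>. i \<in> S \<Longrightarrow> \<alpha> i \<omega> \<ge> 0" and n: "\<And>i \<omega>. i \<in> S \<Longrightarrow> n i \<omega> \<ge> 0"
    and "L > 0"
    and lam: "\<And>\<omega>. \<omega> \<in> space M \<Longrightarrow> (\<Sum>i\<in>S. max 0 (\<alpha> i \<omega> * lam \<omega> - n i \<omega>)) = L"
  shows "lam \<in> borel_measurable M"
proof -
  \<comment> \<open>The filled volume g is nondecreasing in the level, and strictly increasing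
    wherever it is positive. Since g takes the value L > 0 at \<open>lam\<close>, the level is at
    most x exactly if g x \<ge> L, and g at a fixed x is measurable.\<close>
  have "{\<omega> \<in> space M. lam \<omega> \<le> x} = {\<omega> \<in> space M. L \<le> (\<Sum>i\<in>S. max 0 (\<alpha> i \<omega> * x - n i \<omega>))}" for x
  proof (intro Collect_cong conj_cong refl)
    fix \<omega> assume \<omega>: "\<omega> \<in> space M"
    define g where "g z = (\<Sum>i\<in>S. max 0 (\<alpha> i \<omega> * z - n i \<omega>))" for z
    have mono: "max 0 (\<alpha> i \<omega> * z - n i \<omega>) \<le> max 0 (\<alpha> i \<omega> * z' - n i \<omega>)" if "i \<in> S" "z \<le> z'" for i z z'
      using mult_left_mono[OF that(2) \<alpha>[OF that(1), of \<omega>]] by (simp add: max_def)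
    have g_lam: "g (lam \<omega>) = L" using lam[OF \<omega>] by (simp add: g_def)
    have "lam \<omega> \<le> x \<longleftrightarrow> L \<le> g x"
    proof
      assume "lam \<omega> \<le> x"
      then have "g (lam \<omega>) \<le> g x" unfolding g_def by (intro sum_mono mono)
      then show "L \<le> g x" using g_lam by simp
    next
      assume "L \<le> g x"
      show "lam \<omega> \<le> x"
      proof (rule ccontr)
        assume "\<not> lam \<omega> \<le> x"
        then have less: "x < lam \<omega>" by simp
        have "\<exists>i\<in>S. max 0 (\<alpha> i \<omega> * x - n i \<omega>) > 0"
        proof (rule ccontr)
          assume "\<not> ?thesis"
          then have "g x \<le> 0" unfolding g_def by (intro sum_nonpos) (auto simp: not_less)
          then show False using \<open>L \<le> g x\<close> \<open>L > 0\<close> by simp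
        qed
        then obtain i where i: "i \<in> S" "\<alpha> i \<omega> * x - n i \<omega> > 0"
          by (auto simp: max_def split: if_splits)
        then have "\<alpha> i \<omega> > 0" using \<alpha>[OF i(1), of \<omega>] n[OF i(1), of \<omega>] by (cases "\<alpha> i \<omega> = 0") auto
        then have "\<alpha> i \<omega> * x < \<alpha> i \<omega> * lam \<omega>" using less by simp
        then have "max 0 (\<alpha> i \<omega> * x - n i \<omega>) < max 0 (\<alpha> i \<omega> * lam \<omega> - n i \<omega>)" using i(2) by simp
        then have "g x < g (lam \<omega>)"
          unfolding g_def using fin i(1) mono less by (intro sum_strict_mono_ex1) (auto intro!: bexI[of _ i] less_imp_le)
        then show False using \<open>L \<le> g x\<close> g_lam by simp
      qed
    qed
    then show "(lam \<omega> \<le> x) = (L \<le> (\<Sum>i\<in>S. max 0 (\<alpha> i \<omega> * x - n i \<omega>)))" by (simp add: g_def)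
  qed
  then show ?thesis
    unfolding borel_measurable_iff_le using fin by auto
qed

text \<open>Rule (a) is an explicit formula. Rule (b) is not measured through its sorting, but as a
  function of the water level, which is measurable by \<open>measurable_water_level\<close>.\<close>

lemma measurable_alloc_m:
  fixes s :: "nat \<Rightarrow> 'w \<Rightarrow> real" and N :: "nat \<Rightarrow> 'w \<Rightarrow> nat"
  assumes s: "\<And>j \<omega>. s j \<omega> \<ge> 0" and p: "\<And>j. j \<in> {1..I} \<Longrightarrow> p j > 0"
    and p_sum: "(\<Sum>j=1..I. p j) = 1" and L: "L \<ge> 0"
    and s_meas [measurable]: "\<And>j. j \<in> {1..I} \<Longrightarrow> s j \<in> borel_measurable M"
    and N_meas [measurable]: "\<And>j. j \<in> {1..I} \<Longrightarrow> N j \<in> measurable M (count_space UNIV)"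
    and i: "i \<in> {1..I}"
  shows "(\<lambda>\<omega>. alloc_m rule I p (\<lambda>j. s j \<omega>) (\<lambda>j. N j \<omega>) L i) \<in> borel_measurable M"
proof (cases rule)
  case RuleA
  have eq: "alloc_m rule I p (\<lambda>j. s j \<omega>) (\<lambda>j. N j \<omega>) L i =
     (if \<forall>j\<in>{1..I}. s j \<omega> = 0 then p i * L else p i * s i \<omega> / (\<Sum>j=1..I. p j * s j \<omega>) * L)" for \<omega>
    by (simp add: alloc_m_def RuleA)
  have [measurable]: "s i \<in> borel_measurable M" using i by simp
  show ?thesis unfolding eq by measurable
next
  case RuleB
  show ?thesis
  proof (cases "L = 0")
    case True
    \<comment> \<open>For L = 0 the water level is not unique, but nonnegative shares with sum 0 all
      vanish.\<close>
    have "alloc_m rule I p (\<lambda>j. s j \<omega>) (\<lambda>j. N j \<omega>) L i = 0" for \<omega>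
    proof -
      have "\<forall>j\<in>{1..I}. alloc_m rule I p (\<lambda>j. s j \<omega>) (\<lambda>j. N j \<omega>) L j = 0"
        using sum_alloc_m_all_strata[where s = "\<lambda>j. s j \<omega>" and p = p and I = I, OF s p p_sum L] True
        by (subst sum_nonneg_eq_0_iff[symmetric]) auto
      then show ?thesis using i by simp
    qed
    then show ?thesis by simp
  next
    case False
    then have "L > 0" using L by simp
    \<comment> \<open>Replacing an identically zero vector of deviations by 1 guarantees a water
      level at every sample point, so that one function \<open>lam\<close> can be chosen; those
      points are split off again in \<open>eq\<close>.\<close>
    define s' where "s' j \<omega> = (if \<forall>l\<in>{1..I}. s l \<omega> = 0 then 1 else s j \<omega>)" for j \<omega>
    have s': "s' j \<omega> \<ge> 0" for j \<omega> using s by (simp add: s'_def)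
    have s'_meas [measurable]: "s' j \<in> borel_measurable M" if "j \<in> {1..I}" for j
    proof -
      have [measurable]: "s j \<in> borel_measurable M" using that by simp
      show ?thesis unfolding s'_def by measurable
    qed
    have "\<exists>j\<in>{1..I}. s' j \<omega> \<noteq> 0" for \<omega>
      using i by (cases "\<forall>l\<in>{1..I}. s l \<omega> = 0") (auto simp: s'_def)
    then have "\<exists>lam. (\<forall>j\<in>{1..I}. ruleb_alloc I p (\<lambda>j. s' j \<omega>) (\<lambda>j. N j \<omega>) L j =
          max 0 (p j * s' j \<omega> * lam - (real (N j \<omega>) + 1))) \<and>
        (\<Sum>j=1..I. ruleb_alloc I p (\<lambda>j. s' j \<omega>) (\<lambda>j. N j \<omega>) L j) = L" for \<omega>
      by (intro ruleb_alloc_water_level s' p L) auto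
    then obtain lam where lam: "\<And>\<omega> j. j \<in> {1..I} \<Longrightarrow> ruleb_alloc I p (\<lambda>j. s' j \<omega>) (\<lambda>j. N j \<omega>) L j =
          max 0 (p j * s' j \<omega> * lam \<omega> - (real (N j \<omega>) + 1))"
        "\<And>\<omega>. (\<Sum>j=1..I. ruleb_alloc I p (\<lambda>j. s' j \<omega>) (\<lambda>j. N j \<omega>) L j) = L"
      by metis
    have [measurable]: "lam \<in> borel_measurable M"
    proof (rule measurable_water_level[where S = "{1..I}" and L = L])
      show "(\<lambda>\<omega>. p j * s' j \<omega>) \<in> borel_measurable M" if "j \<in> {1..I}" for j
        using s'_meas[OF that] by measurable
      show "(\<lambda>\<omega>. real (N j \<omega>) + 1) \<in> borel_measurable M" if "j \<in> {1..I}" for j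
        using N_meas[OF that] by measurable
      show "(\<Sum>j=1..I. max 0 (p j * s' j \<omega> * lam \<omega> - (real (N j \<omega>) + 1))) = L" for \<omega>
        by (rule trans[OF sum.cong[OF refl lam(1)[symmetric]] lam(2)])
    qed (use s' p \<open>L > 0\<close> in \<open>auto intro!: mult_nonneg_nonneg[OF less_imp_le]\<close>)
    have eq: "alloc_m rule I p (\<lambda>j. s j \<omega>) (\<lambda>j. N j \<omega>) L i =
        (if \<forall>j\<in>{1..I}. s j \<omega> = 0 then p i * L else max 0 (p i * s' i \<omega> * lam \<omega> - (real (N i \<omega>) + 1)))" for \<omega>
    proof (cases "\<forall>j\<in>{1..I}. s j \<omega> = 0")
      case nz: False
      then have "(\<lambda>j. s' j \<omega>) = (\<lambda>j. s j \<omega>)" unfolding s'_def by (subst if_not_P) auto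
      then show ?thesis
        using lam(1)[OF i, of \<omega>] unfolding alloc_m_def if_not_P[OF nz] RuleB by simp
    qed (simp add: alloc_m_def)
    have [measurable]: "s' i \<in> borel_measurable M" "N i \<in> measurable M (count_space UNIV)"
      using i s'_meas by auto
    show ?thesis unfolding eq by measurable
  qed
qed

lemma measurable_sys_round:
  assumes [measurable]: "\<And>j. j \<in> {1..i} \<Longrightarrow> (\<lambda>\<omega>. m \<omega> j) \<in> borel_measurable M"
  shows "(\<lambda>\<omega>. sys_round (m \<omega>) i) \<in> measurable M (count_space UNIV)"
proof -
  have "(\<lambda>\<omega>. \<Sum>l=1..j. m \<omega> l) \<in> borel_measurable M" if "j \<le> i" for j
    by (rule borel_measurable_sum) (use that in auto)
  from this[of i] this[of "i - 1"] show ?thesis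
    unfolding sys_round_def by simp
qed

lemma measurable_emp_sd:
  assumes Y: "\<And>j. j \<ge> 1 \<Longrightarrow> Y i j \<in> borel_measurable M"
    and N: "N \<in> measurable M (count_space UNIV)"
  shows "(\<lambda>\<omega>. emp_sd (\<lambda>i j. Y i j \<omega>) i (N \<omega>)) \<in> borel_measurable M"
proof (rule measurable_compose_countable[OF _ N])
  fix n
  have [measurable]: "(\<lambda>\<omega>. \<Sum>j=1..n. (Y i j \<omega>)\<^sup>2) \<in> borel_measurable M"
      "(\<lambda>\<omega>. \<Sum>j=1..n. Y i j \<omega>) \<in> borel_measurable M"
    by (intro borel_measurable_sum borel_measurable_power Y, simp)+
  show "(\<lambda>\<omega>. emp_sd (\<lambda>i j. Y i j \<omega>) i n) \<in> borel_measurable M"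
    unfolding emp_sd_def by measurable
qed

context allocation
begin

lemma measurable_alloc_N:
  assumes Y: "\<And>i j. i \<in> {1..I} \<Longrightarrow> j \<ge> 1 \<Longrightarrow> Y i j \<in> borel_measurable M" and i: "i \<in> {1..I}"
  shows "(\<lambda>\<omega>. alloc_N rule I p Nseq (\<lambda>i j. Y i j \<omega>) k i) \<in> measurable M (count_space UNIV)"
  using i
proof (induction k arbitrary: i)
  case (Suc k)
  have sd: "(\<lambda>\<omega>. step_sd (\<lambda>i j. Y i j \<omega>) k j) \<in> borel_measurable M" if "j \<in> {1..I}" for j
    unfolding step_sd_def
    by (cases "k = 0") (simp_all add: measurable_emp_sd Y[OF that] Suc.IH[OF that])
  have "(\<lambda>\<omega>. step_m (\<lambda>i j. Y i j \<omega>) k j) \<in> borel_measurable M" if "j \<in> {1..I}" for j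
    unfolding step_m_def
    by (rule measurable_alloc_m) (use p_pos p_sum L_nonneg step_sd_nonneg sd Suc.IH that in auto)
  then have [measurable]: "(\<lambda>\<omega>. sys_round (step_m (\<lambda>i j. Y i j \<omega>) k) i) \<in> measurable M (count_space UNIV)"
    by (intro measurable_sys_round) (use Suc.prems in auto)
  have [measurable]: "(\<lambda>\<omega>. alloc_N rule I p Nseq (\<lambda>i j. Y i j \<omega>) k i) \<in> measurable M (count_space UNIV)"
    by (rule Suc.IH[OF Suc.prems])
  show ?case unfolding alloc_N_Suc by measurable
qed simp

end

section \<open>Asymptotic normality of the adaptive estimator\<close>

text \<open>The estimator sees only the values \<open>f(X\<^sub>i\<^sup>j)\<close>, which
  \<open>Y i j\<close> stands for. Moment conditions are put on the first draw of each stratum and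
  reach the others through \<open>ident\<close>.\<close>

locale stratified_sampling = prob_space M + allocation rule I p Nseq
  for M :: "'w measure" and rule :: alloc_rule and I :: nat and p :: "nat \<Rightarrow> real" and Nseq :: "nat \<Rightarrow> nat" +
  fixes Y :: "nat \<Rightarrow> nat \<Rightarrow> 'w \<Rightarrow> real"
  assumes indep: "indep_vars (\<lambda>_. borel) (\<lambda>(i, j). Y i j) ({1..I} \<times> {1..})"
    and ident: "i \<in> {1..I} \<Longrightarrow> j \<ge> 1 \<Longrightarrow> distr M borel (Y i j) = distr M borel (Y i 1)"
    and square_integrable: "i \<in> {1..I} \<Longrightarrow> integrable M (\<lambda>\<omega>. (Y i 1 \<omega>)\<^sup>2)"
    and some_sd_pos: "\<exists>i\<in>{1..I}. variance (Y i 1) > 0"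
    and k_over_N: "(\<lambda>k. real k / real (Nseq k)) \<longlonglongrightarrow> 0"
begin

definition \<mu> :: "nat \<Rightarrow> real" where "\<mu> i = expectation (Y i 1)"
definition \<sigma> :: "nat \<Rightarrow> real" where "\<sigma> i = sqrt (variance (Y i 1))"
definition \<sigma>star :: real where "\<sigma>star = (\<Sum>i=1..I. p i * \<sigma> i)"
definition q :: "nat \<Rightarrow> real" where "q i = p i * \<sigma> i / \<sigma>star"
definition Z :: "nat \<Rightarrow> nat \<Rightarrow> 'w \<Rightarrow> real" where "Z i j \<omega> = Y i (Suc j) \<omega> - \<mu> i"
definition drawn :: "nat \<Rightarrow> nat \<Rightarrow> 'w \<Rightarrow> nat" where
  "drawn i k \<omega> = alloc_N rule I p Nseq (\<lambda>i j. Y i j \<omega>) k i"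

lemma Y_meas: "i \<in> {1..I} \<Longrightarrow> j \<ge> 1 \<Longrightarrow> Y i j \<in> borel_measurable M"
  using indep by (force simp: indep_vars_def)

lemma \<sigma>_nonneg: "\<sigma> i \<ge> 0"
  by (simp add: \<sigma>_def)

lemma \<sigma>_square: "(\<sigma> i)\<^sup>2 = variance (Y i 1)"
  by (simp add: \<sigma>_def)

lemma I_pos: "I \<ge> 1"
  using some_sd_pos by auto

lemma \<sigma>star_pos: "\<sigma>star > 0"
proof -
  obtain i where i: "i \<in> {1..I}" "variance (Y i 1) > 0" using some_sd_pos by auto
  have "p i * \<sigma> i > 0" using i p_pos[OF i(1)] by (simp add: \<sigma>_def)
  moreover have "p j * \<sigma> j \<ge> 0" if "j \<in> {1..I}" for j
    using p_pos[OF that] \<sigma>_nonneg[of j] by simp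
  ultimately show ?thesis unfolding \<sigma>star_def using i(1) by (intro sum_pos2[of _ i]) auto
qed

lemma q_nonneg: "i \<in> {1..I} \<Longrightarrow> q i \<ge> 0"
  using \<sigma>star_pos p_pos[of i] \<sigma>_nonneg[of i] by (simp add: q_def)

lemma transfer:
  fixes g :: "real \<Rightarrow> real"
  assumes i: "i \<in> {1..I}" "j \<ge> 1" and [measurable]: "g \<in> borel_measurable borel"
  shows "integrable M (\<lambda>\<omega>. g (Y i j \<omega>)) \<longleftrightarrow> integrable M (\<lambda>\<omega>. g (Y i 1 \<omega>))"
    and "expectation (\<lambda>\<omega>. g (Y i j \<omega>)) = expectation (\<lambda>\<omega>. g (Y i 1 \<omega>))"
    and "distr M borel (\<lambda>\<omega>. g (Y i j \<omega>)) = distr M borel (\<lambda>\<omega>. g (Y i 1 \<omega>))"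
proof -
  have [measurable]: "Y i j \<in> borel_measurable M" "Y i 1 \<in> borel_measurable M"
    using i Y_meas by auto
  have "integrable M (\<lambda>\<omega>. g (Y i j \<omega>)) \<longleftrightarrow> integrable (distr M borel (Y i j)) g"
    by (rule integrable_distr_eq[symmetric]) measurable
  also have "\<dots> \<longleftrightarrow> integrable M (\<lambda>\<omega>. g (Y i 1 \<omega>))"
    unfolding ident[OF i] by (rule integrable_distr_eq) measurable
  finally show "integrable M (\<lambda>\<omega>. g (Y i j \<omega>)) \<longleftrightarrow> integrable M (\<lambda>\<omega>. g (Y i 1 \<omega>))" .
  have "expectation (\<lambda>\<omega>. g (Y i j \<omega>)) = integral\<^sup>L (distr M borel (Y i j)) g"
    by (rule integral_distr[symmetric]) measurable
  also have "\<dots> = expectation (\<lambda>\<omega>. g (Y i 1 \<omega>))"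
    unfolding ident[OF i] by (rule integral_distr) measurable
  finally show "expectation (\<lambda>\<omega>. g (Y i j \<omega>)) = expectation (\<lambda>\<omega>. g (Y i 1 \<omega>))" .
  have "distr M borel (\<lambda>\<omega>. g (Y i j \<omega>)) = distr (distr M borel (Y i j)) borel g"
    by (subst distr_distr) (auto simp: comp_def)
  also have "\<dots> = distr M borel (\<lambda>\<omega>. g (Y i 1 \<omega>))"
    unfolding ident[OF i] by (subst distr_distr, measurable) (simp add: comp_def)
  finally show "distr M borel (\<lambda>\<omega>. g (Y i j \<omega>)) = distr M borel (\<lambda>\<omega>. g (Y i 1 \<omega>))" .
qed

lemma row_indep: "i \<in> {1..I} \<Longrightarrow> indep_vars (\<lambda>_. borel) (\<lambda>j. Y i (Suc j)) UNIV"
  using indep_vars_reindex[OF indep, of "\<lambda>j. (i, Suc j)" UNIV] by (simp add: inj_on_def image_subset_iff)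

lemma Y1_integrable: "i \<in> {1..I} \<Longrightarrow> integrable M (Y i 1)"
  by (rule square_integrable_imp_integrable[OF Y_meas square_integrable]) auto

text \<open>The strong law is applied to the values and to their squares; for the squares, a finite
  second moment is exactly the integrability required.\<close>

lemma emp_sd_tendsto:
  assumes i: "i \<in> {1..I}"
  shows "AE \<omega> in M. emp_sd (\<lambda>i j. Y i j \<omega>) i \<longlonglongrightarrow> \<sigma> i"
proof -
  have "AE \<omega> in M. (\<lambda>n. (\<Sum>j<n. Y i (Suc j) \<omega>) / real n) \<longlonglongrightarrow> expectation (Y i (Suc 0))"
  proof (rule strong_law_of_large_numbers[OF row_indep[OF i]])
    show "distr M borel (Y i (Suc n)) = distr M borel (Y i (Suc 0))" for n
      using ident[OF i, of "Suc n"] by simp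
  qed (use Y1_integrable[OF i] in simp)
  moreover have "AE \<omega> in M. (\<lambda>n. (\<Sum>j<n. (Y i (Suc j) \<omega>)\<^sup>2) / real n) \<longlonglongrightarrow> expectation (\<lambda>\<omega>. (Y i (Suc 0) \<omega>)\<^sup>2)"
  proof (rule strong_law_of_large_numbers)
    show "indep_vars (\<lambda>_. borel) (\<lambda>j \<omega>. (Y i (Suc j) \<omega>)\<^sup>2) UNIV"
      by (rule indep_vars_compose2[OF row_indep[OF i]]) simp
    show "distr M borel (\<lambda>\<omega>. (Y i (Suc n) \<omega>)\<^sup>2) = distr M borel (\<lambda>\<omega>. (Y i (Suc 0) \<omega>)\<^sup>2)" for n
      using transfer(3)[OF i, of "Suc n" "\<lambda>x. x\<^sup>2"] by simp
  qed (use square_integrable[OF i] in simp)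
  ultimately show ?thesis
  proof eventually_elim
    case (elim \<omega>)
    have "emp_sd (\<lambda>i j. Y i j \<omega>) i =
        (\<lambda>n. sqrt ((\<Sum>j<n. (Y i (Suc j) \<omega>)\<^sup>2) / real n - ((\<Sum>j<n. Y i (Suc j) \<omega>) / real n)\<^sup>2))"
      by (simp add: fun_eq_iff emp_sd_def sum.atLeast1_atMost_eq)
    moreover have "\<dots> \<longlonglongrightarrow> sqrt (expectation (\<lambda>\<omega>. (Y i (Suc 0) \<omega>)\<^sup>2) - (expectation (Y i (Suc 0)))\<^sup>2)"
      by (intro tendsto_real_sqrt tendsto_diff tendsto_power elim)
    moreover have "\<sigma> i = sqrt (expectation (\<lambda>\<omega>. (Y i (Suc 0) \<omega>)\<^sup>2) - (expectation (Y i (Suc 0)))\<^sup>2)"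
      using variance_eq[OF Y1_integrable[OF i] square_integrable[OF i]] by (simp add: \<sigma>_def)
    ultimately show ?case by simp
  qed
qed

lemma drawn_ratio_tendsto:
  assumes i: "i \<in> {1..I}"
  shows "AE \<omega> in M. (\<lambda>k. real (drawn i k \<omega>) / real (Nseq k)) \<longlonglongrightarrow> q i"
proof -
  have "AE \<omega> in M. \<forall>i\<in>{1..I}. emp_sd (\<lambda>i j. Y i j \<omega>) i \<longlonglongrightarrow> \<sigma> i"
    using emp_sd_tendsto by (simp add: AE_finite_all)
  then show ?thesis
  proof eventually_elim
    case (elim \<omega>)
    show ?case
      unfolding drawn_def q_def \<sigma>star_def
      by (rule alloc_ratio_tendsto) (use elim \<sigma>star_pos k_over_N i in \<open>auto simp: \<sigma>star_def\<close>)
  qed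
qed

lemma drawn_meas: "i \<in> {1..I} \<Longrightarrow> drawn i k \<in> measurable M (count_space UNIV)"
  using measurable_alloc_N[OF Y_meas, where i = i and k = k] unfolding drawn_def by simp

lemma Nseq_at_top: "filterlim (\<lambda>k. real (Nseq k)) at_top sequentially"
  by (rule filterlim_at_top_mono[OF filterlim_real_sequentially]) (use Nseq_ge[OF I_pos] in auto)

lemma Z_indep: "i \<in> {1..I} \<Longrightarrow> indep_vars (\<lambda>_. borel) (Z i) UNIV"
  unfolding Z_def by (rule indep_vars_compose2[OF row_indep]) auto

lemma Z_meas: "i \<in> {1..I} \<Longrightarrow> Z i j \<in> borel_measurable M"
  using Z_indep[of i] by (auto simp: indep_vars_def)

lemma Z_moments:
  assumes i: "i \<in> {1..I}"
  shows "expectation (Z i j) = 0" "integrable M (\<lambda>\<omega>. (Z i j \<omega>)\<^sup>2)"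
    and "expectation (\<lambda>\<omega>. (Z i j \<omega>)\<^sup>2) = (\<sigma> i)\<^sup>2"
    and "distr M borel (Z i j) = distr M borel (\<lambda>\<omega>. Y i 1 \<omega> - \<mu> i)"
proof -
  show "expectation (Z i j) = 0"
    using transfer(2)[OF i, of "Suc j" "\<lambda>x. x - \<mu> i"] Y1_integrable[OF i]
    unfolding Z_def by (simp add: \<mu>_def prob_space)
  have "integrable M (\<lambda>\<omega>. (Y i 1 \<omega> - \<mu> i)\<^sup>2)"
    unfolding power2_diff using Y1_integrable[OF i] square_integrable[OF i] by simp
  then show "integrable M (\<lambda>\<omega>. (Z i j \<omega>)\<^sup>2)"
    using transfer(1)[OF i, of "Suc j" "\<lambda>x. (x - \<mu> i)\<^sup>2"] unfolding Z_def by simp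
  show "expectation (\<lambda>\<omega>. (Z i j \<omega>)\<^sup>2) = (\<sigma> i)\<^sup>2"
    using transfer(2)[OF i, of "Suc j" "\<lambda>x. (x - \<mu> i)\<^sup>2"] unfolding Z_def \<sigma>_square by (simp add: \<mu>_def)
  show "distr M borel (Z i j) = distr M borel (\<lambda>\<omega>. Y i 1 \<omega> - \<mu> i)"
    using transfer(3)[OF i, of "Suc j" "\<lambda>x. x - \<mu> i"] unfolding Z_def by simp
qed

section \<open>Comparison with deterministic sample sizes\<close>

definition target :: "nat \<Rightarrow> nat \<Rightarrow> nat" where "target i k = nat \<lfloor>q i * real (Nseq k)\<rfloor>"

text \<open>If \<open>\<sigma> i = 0\<close>, division by zero makes both \<open>W i k\<close> and \<open>b i\<close> below vanish.\<close>

definition W :: "nat \<Rightarrow> nat \<Rightarrow> 'w \<Rightarrow> real" where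
  "W i k \<omega> = (\<Sum>j<target i k. Z i j \<omega>) / sqrt (real (target i k) * (\<sigma> i)\<^sup>2)"

text \<open>The contribution of stratum i to the scaled error of the estimator; it is 0 at k =
  0.\<close>

definition T :: "nat \<Rightarrow> nat \<Rightarrow> 'w \<Rightarrow> real" where
  "T i k \<omega> = sqrt (real (Nseq k)) * (p i / real (drawn i k \<omega>) * (\<Sum>j<drawn i k \<omega>. Z i j \<omega>))"

text \<open>The limiting standard deviation of \<open>T i k\<close>: with about q N draws,
  \<open>sqrt N * p / (q N) * \<sigma> * sqrt (q N)\<close> equals p \<sigma> / sqrt q.\<close>

definition b :: "nat \<Rightarrow> real" where "b i = p i * \<sigma> i / sqrt (q i)"

lemma target_ratio_tendsto:
  assumes i: "i \<in> {1..I}"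
  shows "(\<lambda>k. real (target i k) / real (Nseq k)) \<longlonglongrightarrow> q i"
proof -
  have "(\<lambda>k. real (target i k) / real (Nseq k) - q i) \<longlonglongrightarrow> 0"
  proof (rule tendsto_rabs_zero_cancel, rule tendsto_sandwich[OF _ _ tendsto_const])
    show "(\<lambda>k. 1 / real (Nseq k)) \<longlonglongrightarrow> 0"
      by (rule real_tendsto_divide_at_top[OF tendsto_const Nseq_at_top])
    show "eventually (\<lambda>k. \<bar>real (target i k) / real (Nseq k) - q i\<bar> \<le> 1 / real (Nseq k)) sequentially"
      using eventually_gt_at_top[of 0]
    proof eventually_elim
      case (elim k)
      then have N: "real (Nseq k) > 0" using Nseq_ge[OF I_pos, of k] by simp
      have "q i * real (Nseq k) \<ge> 0" using q_nonneg[OF i] by simp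
      then have "\<bar>real (target i k) - q i * real (Nseq k)\<bar> \<le> 1"
        unfolding target_def by linarith
      moreover have "real (target i k) / real (Nseq k) - q i =
          (real (target i k) - q i * real (Nseq k)) / real (Nseq k)"
        using N by (simp add: field_simps)
      ultimately show ?case using N by (simp add: abs_divide divide_right_mono)
    qed
  qed simp
  then show ?thesis by (simp add: LIM_zero_iff)
qed

lemma W_meas: "i \<in> {1..I} \<Longrightarrow> W i k \<in> borel_measurable M"
  unfolding W_def using Z_meas[of i] by measurable

lemma T_meas:
  assumes i: "i \<in> {1..I}"
  shows "T i k \<in> borel_measurable M"
proof -
  note drawn_meas[OF i, measurable]
  have [measurable]: "(\<lambda>\<omega>. \<Sum>j<drawn i k \<omega>. Z i j \<omega>) \<in> borel_measurable M"
    by (rule measurable_random_sum) (use Z_meas drawn_meas i in auto)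
  show ?thesis unfolding T_def by measurable
qed

text \<open>Tightness of \<open>W\<close>, uniformly in k. It is Chebyshev's inequality for a
  variable of unit variance, read off from the maximal inequality at the last partial sum; if the
  normalisation is 0, \<open>W\<close> is identically 0.\<close>

lemma prob_W_exceeds:
  assumes i: "i \<in> {1..I}" and "K > 0"
  shows "prob {\<omega> \<in> space M. \<bar>W i k \<omega>\<bar> > K} \<le> 1 / K\<^sup>2"
proof (cases "real (target i k) * (\<sigma> i)\<^sup>2 = 0")
  case True
  then have "{\<omega> \<in> space M. \<bar>W i k \<omega>\<bar> > K} = {}" using \<open>K > 0\<close> by (auto simp: W_def)
  then show ?thesis by (simp only: measure_empty) simp
next
  case False
  define s where "s = sqrt (real (target i k) * (\<sigma> i)\<^sup>2)"
  have "real (target i k) * (\<sigma> i)\<^sup>2 > 0" using False by (simp add: order_le_less)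
  then have s: "s > 0" "s\<^sup>2 = real (target i k) * (\<sigma> i)\<^sup>2" by (auto simp: s_def)
  have [measurable]: "Z i j \<in> borel_measurable M" for j using Z_meas[OF i] .
  have "prob {\<omega> \<in> space M. \<bar>W i k \<omega>\<bar> > K} \<le>
      prob {\<omega> \<in> space M. \<exists>m\<le>target i k. K * s \<le> \<bar>\<Sum>j<m. Z i j \<omega>\<bar>}"
  proof (rule finite_measure_mono)
    show "{\<omega> \<in> space M. \<bar>W i k \<omega>\<bar> > K} \<subseteq> {\<omega> \<in> space M. \<exists>m\<le>target i k. K * s \<le> \<bar>\<Sum>j<m. Z i j \<omega>\<bar>}"
      using s(1) unfolding W_def s_def[symmetric]
      by (auto simp: abs_divide pos_less_divide_eq intro!: exI[of _ "target i k"])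
  qed measurable
  also have "\<dots> \<le> (\<Sum>j<target i k. expectation (\<lambda>\<omega>. (Z i j \<omega>)\<^sup>2)) / (K * s)\<^sup>2"
    by (rule Kolmogorov_maximal_inequality[OF indep_vars_subset[OF Z_indep[OF i]]])
       (use Z_moments[OF i] \<open>K > 0\<close> s in auto)
  also have "\<dots> = 1 / K\<^sup>2" using s \<open>K > 0\<close> False by (simp add: Z_moments[OF i] power_mult_distrib)
  finally show ?thesis .
qed

text \<open>Here q i = 0, so the inverse sampling proportion has no finite limit to work with.
  Instead all centred draws vanish simultaneously almost surely, being countably many variables of
  variance 0.\<close>

lemma T_approx_degenerate:
  assumes i: "i \<in> {1..I}" and "\<sigma> i = 0"
  shows "vanishes_in_prob (\<lambda>k \<omega>. T i k \<omega> - b i * W i k \<omega>)"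
proof (rule vanishes_in_prob_AE)
  show "(\<lambda>\<omega>. T i k \<omega> - b i * W i k \<omega>) \<in> borel_measurable M" for k
    using T_meas[OF i] W_meas[OF i] by measurable
  have "AE \<omega> in M. \<forall>j. Z i j \<omega> = 0"
    unfolding AE_all_countable
  proof
    fix j
    have "AE \<omega> in M. (Z i j \<omega>)\<^sup>2 = 0"
      using integral_nonneg_eq_0_iff_AE[OF Z_moments(2)[OF i, of j]] Z_moments(3)[OF i, of j] \<open>\<sigma> i = 0\<close>
      by simp
    then show "AE \<omega> in M. Z i j \<omega> = 0" by simp
  qed
  then show "AE \<omega> in M. (\<lambda>k. T i k \<omega> - b i * W i k \<omega>) \<longlonglongrightarrow> 0"
    by eventually_elim (simp add: T_def W_def)
qed

text \<open>The difference equals A D + W (A s - b), where \<open>A\<close> is p i over the sampling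
  proportion, \<open>D\<close> is Anscombe's difference and \<open>s\<close> is the normalisation of
  \<open>W\<close> relative to sqrt N. The first product is convergent times vanishing. The second
  is tight times vanishing, because A s tends to (p i / q i) sqrt (q i) \<sigma> i = b i.\<close>

lemma T_approx_nondegenerate:
  assumes i: "i \<in> {1..I}" and "\<sigma> i > 0"
  shows "vanishes_in_prob (\<lambda>k \<omega>. T i k \<omega> - b i * W i k \<omega>)"
proof -
  have q: "q i > 0" using p_pos[OF i] \<sigma>star_pos \<open>\<sigma> i > 0\<close> by (simp add: q_def)
  note drawn_meas[OF i, measurable] Z_meas[OF i, measurable] W_meas[OF i, measurable]
  define A where "A k \<omega> = p i / (real (drawn i k \<omega>) / real (Nseq k))" for k \<omega>
  define D where "D k \<omega> = ((\<Sum>j<drawn i k \<omega>. Z i j \<omega>) - (\<Sum>j<target i k. Z i j \<omega>)) / sqrt (real (Nseq k))" for k \<omega>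
  define s where "s k = sqrt (real (target i k) / real (Nseq k) * (\<sigma> i)\<^sup>2)" for k
  have [measurable]: "A k \<in> borel_measurable M" for k unfolding A_def by measurable
  have A_lim: "AE \<omega> in M. (\<lambda>k. A k \<omega>) \<longlonglongrightarrow> p i / q i"
    using drawn_ratio_tendsto[OF i]
    unfolding A_def by eventually_elim (intro tendsto_divide tendsto_const, use q in auto)
  have s_lim: "s \<longlonglongrightarrow> sqrt (q i * (\<sigma> i)\<^sup>2)"
    unfolding s_def by (intro tendsto_real_sqrt tendsto_mult_right target_ratio_tendsto i)
  have "sqrt (q i) * sqrt (q i) = q i" using q by simp
  then have b_eq: "p i / q i * sqrt (q i * (\<sigma> i)\<^sup>2) = b i"
    using q \<sigma>_nonneg[of i] by (simp add: b_def real_sqrt_mult field_simps)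
  have "vanishes_in_prob D"
    unfolding D_def
    by (rule Anscombe[where v = "(\<sigma> i)\<^sup>2", OF Z_indep[OF i] Z_moments(2,1)[OF i] _ drawn_meas[OF i] Nseq_at_top
          drawn_ratio_tendsto[OF i] target_ratio_tendsto[OF i]]) (simp add: Z_moments(3)[OF i])
  then have 1: "vanishes_in_prob (\<lambda>k \<omega>. A k \<omega> * D k \<omega>)"
    by (rule vanishes_in_prob_mult_tendsto[OF _ _ A_lim]) measurable
  have "vanishes_in_prob (\<lambda>k \<omega>. A k \<omega> * s k - b i)"
  proof (rule vanishes_in_prob_AE)
    show "AE \<omega> in M. (\<lambda>k. A k \<omega> * s k - b i) \<longlonglongrightarrow> 0"
      using A_lim
    proof eventually_elim
      case (elim \<omega>)
      from tendsto_mult[OF this s_lim] show ?case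
        unfolding b_eq by (simp add: LIM_zero_iff)
    qed
  qed measurable
  then have 2: "vanishes_in_prob (\<lambda>k \<omega>. W i k \<omega> * (A k \<omega> * s k - b i))"
  proof (rule vanishes_in_prob_mult)
    fix d :: real assume "d > 0"
    \<comment> \<open>The level K = 1 / sqrt d turns the bound \<open>1 / K\<^sup>2\<close> into
      d.\<close>
    have "prob {\<omega> \<in> space M. \<bar>W i k \<omega>\<bar> > 1 / sqrt d} \<le> d" for k
      using prob_W_exceeds[OF i, of "1 / sqrt d" k] \<open>d > 0\<close> by (simp add: power_divide)
    then show "\<exists>K>0. eventually (\<lambda>k. prob {\<omega> \<in> space M. \<bar>W i k \<omega>\<bar> > K} \<le> d) sequentially"
      using \<open>d > 0\<close> by (intro exI[of _ "1 / sqrt d"]) auto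
  qed measurable
  have "T i k \<omega> - b i * W i k \<omega> = A k \<omega> * D k \<omega> + W i k \<omega> * (A k \<omega> * s k - b i)" for k \<omega>
  proof (cases "Nseq k = 0")
    \<comment> \<open>This is k = 0, where every term is 0 by the convention on division by
      zero.\<close>
    case True
    then have "target i k = 0" by (simp add: target_def)
    then show ?thesis using True by (simp add: T_def A_def D_def W_def)
  next
    case False
    then have N: "sqrt (real (Nseq k)) > 0" "sqrt (real (Nseq k)) * sqrt (real (Nseq k)) = real (Nseq k)" by auto
    have Ws: "W i k \<omega> * s k = (\<Sum>j<target i k. Z i j \<omega>) / sqrt (real (Nseq k))"
      using \<open>\<sigma> i > 0\<close> N(1) by (cases "target i k = 0") (auto simp: W_def s_def real_sqrt_mult real_sqrt_divide)
    have "T i k \<omega> = A k \<omega> * ((\<Sum>j<drawn i k \<omega>. Z i j \<omega>) / sqrt (real (Nseq k)))"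
    proof -
      have "A k \<omega> * ((\<Sum>j<drawn i k \<omega>. Z i j \<omega>) / sqrt (real (Nseq k))) =
          real (Nseq k) / sqrt (real (Nseq k)) * (p i / real (drawn i k \<omega>) * (\<Sum>j<drawn i k \<omega>. Z i j \<omega>))"
        by (simp add: A_def mult_ac)
      then show ?thesis by (simp add: T_def real_div_sqrt)
    qed
    also have "\<dots> = A k \<omega> * D k \<omega> + A k \<omega> * (W i k \<omega> * s k)"
      unfolding Ws D_def by (simp add: diff_divide_distrib algebra_simps)
    finally show ?thesis by (simp add: algebra_simps)
  qed
  then show ?thesis using vanishes_in_prob_add[OF 1 2] by simp
qed

text \<open>The central limit theorem for the row, read along the deterministic indices
  \<open>target i k\<close>, which tend to infinity because q i > 0.\<close>

lemma W_char_tendsto: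
  assumes i: "i \<in> {1..I}" and "\<sigma> i > 0"
  shows "(\<lambda>k. char (distr M borel (W i k)) t) \<longlonglongrightarrow> exp (- t\<^sup>2 / 2)"
proof -
  have q: "q i > 0" using p_pos[OF i] \<sigma>star_pos \<open>\<sigma> i > 0\<close> by (simp add: q_def)
  note Z_meas[OF i, measurable]
  define V where "V n \<omega> = (\<Sum>j<n. Z i j \<omega>) / sqrt (real n * (\<sigma> i)\<^sup>2)" for n \<omega>
  have "weak_conv_m (\<lambda>n. distr M borel (V n)) std_normal_distribution"
    unfolding V_def
    by (rule central_limit_theorem_zero_mean[OF Z_indep[OF i] Z_moments(1)[OF i] \<open>\<sigma> i > 0\<close> Z_moments(2)[OF i]])
       (use Z_moments[OF i] in auto)
  then have "(\<lambda>n. char (distr M borel (V n)) t) \<longlonglongrightarrow> char std_normal_distribution t"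
  proof (rule levy_continuity1[rotated 2])
    show "real_distribution (distr M borel (V n))" for n
      by (rule real_distribution_distr) (unfold V_def, measurable)
  qed (rule real_dist_normal_dist)
  moreover have "filterlim (target i) at_top sequentially"
  proof -
    have "filterlim (\<lambda>k. q i * real (Nseq k)) at_top sequentially"
      by (rule filterlim_tendsto_pos_mult_at_top[OF tendsto_const q Nseq_at_top])
    from filterlim_compose[OF filterlim_nat_sequentially filterlim_compose[OF filterlim_floor_sequentially this]]
    show ?thesis unfolding target_def .
  qed
  ultimately have "(\<lambda>k. char (distr M borel (V (target i k))) t) \<longlonglongrightarrow> char std_normal_distribution t"
    by (rule filterlim_compose)
  moreover have "W i k = V (target i k)" for k by (simp add: V_def W_def fun_eq_iff)
  ultimately show ?thesis by (simp add: char_std_normal_distribution)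
qed

text \<open>The gain from replacing the sample sizes: as \<open>target i k\<close> is deterministic,
  \<open>W i k\<close> is a function of row i alone, whereas each random size may depend on all
  rows.\<close>

lemma W_indep: "indep_vars (\<lambda>_. borel) (\<lambda>i. W i k) {1..I}"
proof -
  let ?K = "\<lambda>i. {i} \<times> {1::nat..}"
  have "indep_vars (\<lambda>i. PiM (?K i) (\<lambda>_. borel)) (\<lambda>i \<omega>. restrict (\<lambda>x. (\<lambda>(i, j). Y i j) x \<omega>) (?K i)) {1..I}"
    by (rule indep_vars_restrict[OF indep]) (auto simp: disjoint_family_on_def)
  then have "indep_vars (\<lambda>_. borel) (\<lambda>i \<omega>.
      (\<lambda>g. (\<Sum>j<target i k. g (i, Suc j) - \<mu> i) / sqrt (real (target i k) * (\<sigma> i)\<^sup>2))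
        (restrict (\<lambda>x. (\<lambda>(i, j). Y i j) x \<omega>) (?K i))) {1..I}"
  proof (rule indep_vars_compose2)
    fix i :: nat
    have [measurable]: "(\<lambda>g. g (i, Suc j)) \<in> borel_measurable (PiM (?K i) (\<lambda>_. borel))" for j
      by (rule measurable_component_singleton) simp
    show "(\<lambda>g. (\<Sum>j<target i k. g (i, Suc j) - \<mu> i) / sqrt (real (target i k) * (\<sigma> i)\<^sup>2))
        \<in> borel_measurable (PiM (?K i) (\<lambda>_. borel))"
      by measurable
  qed
  then show ?thesis by (simp add: W_def[abs_def] Z_def)
qed

text \<open>By the choice of q, p \<sigma> / q is the constant \<sigma>star if \<sigma> i > 0, so
  the limiting variances p \<sigma> \<sigma>star add up to the square of \<sigma>star. If \<sigma> i
  = 0, both sides are 0.\<close>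

lemma b_square: "i \<in> {1..I} \<Longrightarrow> (b i)\<^sup>2 = p i * \<sigma> i * \<sigma>star"
  using q_nonneg[of i] p_pos[of i] \<sigma>star_pos
  by (simp add: b_def power_divide) (simp add: q_def power2_eq_square)

theorem estimator_clt:
  "weak_conv_m
     (\<lambda>k. distr M borel (\<lambda>\<omega>. sqrt (real (Nseq k)) *
        (strat_est rule I p Nseq (\<lambda>i j. Y i j \<omega>) k - (\<Sum>i=1..I. p i * \<mu> i))))
     (density lborel (normal_density 0 \<sigma>star))"
proof -
  let ?U = "\<lambda>k \<omega>. sqrt (real (Nseq k)) *
        (strat_est rule I p Nseq (\<lambda>i j. Y i j \<omega>) k - (\<Sum>i=1..I. p i * \<mu> i))"
  have U_eq: "?U k = (\<lambda>\<omega>. \<Sum>i=1..I. T i k \<omega>)" for k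
  proof
    fix \<omega>
    show "?U k \<omega> = (\<Sum>i=1..I. T i k \<omega>)"
    proof (cases "k = 0")
      \<comment> \<open>No draw has been made yet; the factor sqrt 0 makes both sides 0.\<close>
      case True
      then show ?thesis by (simp add: N0 T_def)
    next
      case False
      have "p i / real (drawn i k \<omega>) * (\<Sum>j=1..drawn i k \<omega>. Y i j \<omega>) - p i * \<mu> i =
          p i / real (drawn i k \<omega>) * (\<Sum>j<drawn i k \<omega>. Z i j \<omega>)" for i
      proof -
        have "drawn i k \<omega> > 0"
          using alloc_N_ge[of k "\<lambda>i j. Y i j \<omega>" i] False by (simp add: drawn_def)
        then show ?thesis
          by (simp add: Z_def sum.atLeast1_atMost_eq sum_subtractf field_simps)
      qed
      note stratum = this
      have "?U k \<omega> = sqrt (real (Nseq k)) * (\<Sum>i=1..I.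
          p i / real (drawn i k \<omega>) * (\<Sum>j=1..drawn i k \<omega>. Y i j \<omega>) - p i * \<mu> i)"
        by (simp only: strat_est_def drawn_def sum_subtractf)
      also have "\<dots> = (\<Sum>i=1..I. T i k \<omega>)"
        unfolding stratum T_def by (rule sum_distrib_left)
      finally show ?thesis .
    qed
  qed
  have T_sum_meas: "(\<lambda>\<omega>. \<Sum>i=1..I. T i k \<omega>) \<in> borel_measurable M" for k
    by (intro borel_measurable_sum T_meas)
  have W_sum_meas: "(\<lambda>\<omega>. \<Sum>i=1..I. b i * W i k \<omega>) \<in> borel_measurable M" for k
    by (intro borel_measurable_sum borel_measurable_times borel_measurable_const W_meas)
  have "vanishes_in_prob (\<lambda>k \<omega>. \<Sum>i=1..I. T i k \<omega> - b i * W i k \<omega>)"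
    using T_approx_degenerate T_approx_nondegenerate \<sigma>_nonneg
    by (intro vanishes_in_prob_sum) (metis order_le_less)
  then have approx: "vanishes_in_prob (\<lambda>k \<omega>. (\<Sum>i=1..I. T i k \<omega>) - (\<Sum>i=1..I. b i * W i k \<omega>))"
    by (simp add: sum_subtractf)
  have W_lim: "(\<lambda>k. char (distr M borel (\<lambda>\<omega>. \<Sum>i=1..I. b i * W i k \<omega>)) t)
      \<longlonglongrightarrow> exp (- (\<sigma>star * t)\<^sup>2 / 2)" for t
  proof -
    have "char (distr M borel (\<lambda>\<omega>. \<Sum>i=1..I. b i * W i k \<omega>)) t =
        (\<Prod>i=1..I. char (distr M borel (W i k)) (b i * t))" for k
    proof -
      have "char (distr M borel (\<lambda>\<omega>. \<Sum>i=1..I. b i * W i k \<omega>)) t =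
          (\<Prod>i=1..I. char (distr M borel (\<lambda>\<omega>. b i * W i k \<omega>)) t)"
        by (rule char_distr_sum, rule indep_vars_compose2[OF W_indep]) measurable
      also have "\<dots> = (\<Prod>i=1..I. char (distr M borel (W i k)) (b i * t))"
        by (intro prod.cong refl char_distr_scale W_meas)
      finally show ?thesis .
    qed
    moreover have "(\<lambda>k. \<Prod>i=1..I. char (distr M borel (W i k)) (b i * t)) \<longlonglongrightarrow>
        (\<Prod>i=1..I. complex_of_real (exp (- (b i * t)\<^sup>2 / 2)))"
    proof (rule tendsto_prod)
      fix i assume i: "i \<in> {1..I}"
      show "(\<lambda>k. char (distr M borel (W i k)) (b i * t)) \<longlonglongrightarrow> complex_of_real (exp (- (b i * t)\<^sup>2 / 2))"
      proof (cases "\<sigma> i = 0")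
        case True
        \<comment> \<open>For a degenerate stratum b i = 0, so the characteristic function is
          evaluated at 0 only.\<close>
        have "char (distr M borel (W i k)) 0 = 1" for k
          using real_distribution.char_zero[OF real_distribution_distr[OF W_meas[OF i]]] .
        then show ?thesis using True by (simp add: b_def)
      next
        case False
        then show ?thesis using W_char_tendsto[OF i] \<sigma>_nonneg[of i] by (simp add: order_le_less)
      qed
    qed
    moreover have "(\<Prod>i=1..I. complex_of_real (exp (- (b i * t)\<^sup>2 / 2))) =
        complex_of_real (exp (- (\<sigma>star * t)\<^sup>2 / 2))"
    proof -
      have "(\<Sum>i=1..I. - (b i * t)\<^sup>2 / 2) = (\<Sum>i=1..I. p i * \<sigma> i * (- (\<sigma>star * t\<^sup>2) / 2))"
        by (rule sum.cong) (simp_all add: power_mult_distrib b_square)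
      also have "\<dots> = \<sigma>star * (- (\<sigma>star * t\<^sup>2) / 2)"
        unfolding \<sigma>star_def by (rule sum_distrib_right[symmetric])
      also have "\<dots> = - (\<sigma>star * t)\<^sup>2 / 2" by (simp add: power2_eq_square)
      finally have *: "(\<Sum>i=1..I. - (b i * t)\<^sup>2 / 2) = - (\<sigma>star * t)\<^sup>2 / 2" .
      have "(\<Prod>i=1..I. exp (- (b i * t)\<^sup>2 / 2)) = exp (- (\<sigma>star * t)\<^sup>2 / 2)"
        unfolding *[symmetric] by (rule exp_sum[symmetric]) simp
      then show ?thesis unfolding of_real_prod[symmetric] by (rule arg_cong)
    qed
    ultimately show ?thesis by simp
  qed
  show ?thesis
    unfolding U_eq
  proof (rule levy_continuity)
    show "real_distribution (distr M borel (\<lambda>\<omega>. \<Sum>i=1..I. T i k \<omega>))" for k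
      by (rule real_distribution_distr[OF T_sum_meas])
    show "real_distribution (density lborel (normal_density 0 \<sigma>star))"
      by (simp add: real_distribution_def real_distribution_axioms_def prob_space_normal_density \<sigma>star_pos)
    show "(\<lambda>k. char (distr M borel (\<lambda>\<omega>. \<Sum>i=1..I. T i k \<omega>)) t)
        \<longlonglongrightarrow> char (density lborel (normal_density 0 \<sigma>star)) t" for t
      unfolding char_normal[OF \<sigma>star_pos]
      by (rule char_tendsto_if_vanishes_in_prob[OF T_sum_meas W_sum_meas approx W_lim])
  qed
qed

end

section \<open>Conditional laws and the theorem for the original data\<close>

lemma
  fixes g :: "'a \<Rightarrow> real"
  assumes "prob_space D" and A [measurable]: "A \<in> sets D" and pos: "measure D A > 0"
    and g [measurable]: "g \<in> borel_measurable D"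
  shows integral_uniform_measure:
      "integral\<^sup>L (uniform_measure D A) g = (\<integral>x. indicator A x * g x \<partial>D) / measure D A"
    and integrable_uniform_measure: "integrable D g \<Longrightarrow> integrable (uniform_measure D A) g"
proof -
  interpret D: prob_space D by fact
  \<comment> \<open>\<open>uniform_measure\<close> is defined with a quotient in
    \<open>ennreal\<close>; as the image of a real density it fits the rules for Bochner
    integrals.\<close>
  have eq: "uniform_measure D A = density D (\<lambda>x. ennreal (indicator A x / measure D A))"
    unfolding uniform_measure_def
  proof (intro arg_cong2[where f = density] ext refl)
    fix x
    show "indicator A x / emeasure D A = ennreal (indicator A x / measure D A)"
      using pos by (simp add: D.emeasure_eq_measure divide_ennreal[symmetric] ennreal_indicator)
  qed
  show "integral\<^sup>L (uniform_measure D A) g = (\<integral>x. indicator A x * g x \<partial>D) / measure D A"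
    unfolding eq using pos by (subst integral_density) (auto simp: less_imp_le)
  assume int: "integrable D g"
  then show "integrable (uniform_measure D A) g"
    unfolding eq using pos integrable_real_mult_indicator[OF A int]
    by (subst integrable_density) (auto simp: less_imp_le mult.commute)
qed

theorem theorem2p1:
  fixes M :: "'w measure"
    and X :: "'w \<Rightarrow> real ^ 'd"
    and f :: "real ^ 'd \<Rightarrow> real"
    and I :: nat
    and A :: "nat \<Rightarrow> (real ^ 'd) set"
    and p :: "nat \<Rightarrow> real"
    and Xs :: "nat \<Rightarrow> nat \<Rightarrow> 'w \<Rightarrow> real ^ 'd"
    and Nseq :: "nat \<Rightarrow> nat"
    and rule :: alloc_rule
  assumes M: "prob_space M"
    and X: "X \<in> borel_measurable M"
    and f: "f \<in> borel_measurable borel"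
    and A_meas: "\<forall>i\<in>{1..I}. A i \<in> sets borel"
    and A_disj: "disjoint_family_on A {1..I}"
    and A_cover: "(\<Union>i\<in>{1..I}. A i) = UNIV"
    and p_def: "\<forall>i\<in>{1..I}. p i = measure M {\<omega> \<in> space M. X \<omega> \<in> A i}"
    and p_pos: "\<forall>i\<in>{1..I}. p i > 0"
    and f2: "integrable M (\<lambda>\<omega>. (f (X \<omega>))^2)"
    and H: "\<exists>i\<in>{1..I}. law_sd (uniform_measure (distr M borel X) (A i)) f > 0"
    and Xs_indep: "prob_space.indep_vars M (\<lambda>_. borel) (\<lambda>(i, j). Xs i j) ({1..I} \<times> {1..})"
    and Xs_law: "\<forall>i\<in>{1..I}. \<forall>j\<ge>1. distr M borel (Xs i j) = uniform_measure (distr M borel X) (A i)"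
    and N0: "Nseq 0 = 0"
    and N_incr: "\<forall>k\<ge>1. Nseq k \<ge> Nseq (k - 1) + I"
    and N_strict: "strict_mono Nseq"
    and k_over_N: "(\<lambda>k. real k / real (Nseq k)) \<longlonglongrightarrow> 0"
  shows "weak_conv_m
           (\<lambda>k. distr M borel (\<lambda>\<omega>. sqrt (real (Nseq k)) *
               (strat_est rule I p Nseq (\<lambda>i j. f (Xs i j \<omega>)) k - integral\<^sup>L M (\<lambda>\<omega>. f (X \<omega>)))))
           (density lborel (normal_density 0
              (\<Sum>i=1..I. p i * law_sd (uniform_measure (distr M borel X) (A i)) f)))"
proof -
  interpret prob_space M by (rule M)
  note X[measurable] f[measurable]
  define D where "D = distr M borel X"
  define \<nu> where "\<nu> i = uniform_measure D (A i)" for i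
  interpret D: prob_space D unfolding D_def by (rule prob_space_distr) measurable
  have [measurable_cong]: "sets D = sets borel" by (simp add: D_def)
  have A_sets [measurable]: "i \<in> {1..I} \<Longrightarrow> A i \<in> sets D" for i using A_meas by (simp add: D_def)
  have p_eq: "p i = measure D (A i)" if "i \<in> {1..I}" for i
    using that p_def A_meas
    by (auto simp: D_def measure_distr vimage_def Int_def conj_commute intro!: arg_cong[where f = "measure M"])
  have Xs_meas: "Xs i j \<in> borel_measurable M" if "i \<in> {1..I}" "j \<ge> 1" for i j
    using Xs_indep that by (force simp: indep_vars_def)
  have f2_D: "integrable D (\<lambda>x. (f x)\<^sup>2)"
    unfolding D_def using f2 by (subst integrable_distr_eq) auto
  have f_D: "integrable D f"
    by (rule D.square_integrable_imp_integrable[OF _ f2_D]) measurable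
  define Y where "Y i j \<omega> = f (Xs i j \<omega>)" for i j \<omega>
  \<comment> \<open>With an arbitrary g, one transfer between draws and conditional law serves the
    mean, the second moment and the variance.\<close>
  have law: "expectation (\<lambda>\<omega>. g (Y i j \<omega>)) = (\<integral>x. g (f x) \<partial>\<nu> i)"
      "integrable M (\<lambda>\<omega>. g (Y i j \<omega>)) \<longleftrightarrow> integrable (\<nu> i) (\<lambda>x. g (f x))"
      "distr M borel (Y i j) = distr (\<nu> i) borel f"
    if ij: "i \<in> {1..I}" "j \<ge> 1" and [measurable]: "g \<in> borel_measurable borel" for i j and g :: "real \<Rightarrow> real"
  proof -
    note Xs_meas[OF ij, measurable]
    have eq: "\<nu> i = distr M borel (Xs i j)" using Xs_law ij by (simp add: \<nu>_def D_def)
    show "expectation (\<lambda>\<omega>. g (Y i j \<omega>)) = (\<integral>x. g (f x) \<partial>\<nu> i)"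
      unfolding eq Y_def by (subst integral_distr) auto
    show "integrable M (\<lambda>\<omega>. g (Y i j \<omega>)) \<longleftrightarrow> integrable (\<nu> i) (\<lambda>x. g (f x))"
      unfolding eq Y_def by (subst integrable_distr_eq) auto
    show "distr M borel (Y i j) = distr (\<nu> i) borel f"
      unfolding eq Y_def[abs_def] by (subst distr_distr) (auto simp: comp_def)
  qed
  have mean: "expectation (Y i 1) = (\<integral>x. f x \<partial>\<nu> i)" if "i \<in> {1..I}" for i
    using law(1)[OF that, of 1 "\<lambda>x. x"] by simp
  have sd: "law_sd (\<nu> i) f = sqrt (variance (Y i 1))" if "i \<in> {1..I}" for i
    using law(1)[OF that, of 1 "\<lambda>x. (x - (\<integral>x. f x \<partial>\<nu> i))\<^sup>2"]
    unfolding law_sd_def mean[OF that] by simp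
  have ind_sum: "(\<Sum>i=1..I. indicator (A i) x) = (1 :: real)" for x
    using indicator_UN_disjoint[OF _ A_disj, of x] unfolding A_cover by simp
  have int_A: "integrable D (\<lambda>x. indicator (A i) x * g x)" if "i \<in> {1..I}" "integrable D g" for i and g :: "_ \<Rightarrow> real"
    using integrable_real_mult_indicator[OF A_sets[OF that(1)] that(2)] by (simp add: mult.commute)
  have split: "(\<Sum>i=1..I. \<integral>x. indicator (A i) x * g x \<partial>D) = (\<integral>x. g x \<partial>D)"
    if g: "integrable D g" for g :: "_ \<Rightarrow> real"
  proof -
    have "(\<Sum>i=1..I. \<integral>x. indicator (A i) x * g x \<partial>D) = (\<integral>x. (\<Sum>i=1..I. indicator (A i) x * g x) \<partial>D)"
      by (rule Bochner_Integration.integral_sum[symmetric]) (rule int_A[OF _ g])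
    then show ?thesis unfolding sum_distrib_right[symmetric] ind_sum by simp
  qed
  interpret stratified_sampling M rule I p Nseq Y
  proof
    show "p i > 0" if "i \<in> {1..I}" for i using p_pos that by simp
    have "(\<Sum>i=1..I. p i) = (\<Sum>i=1..I. \<integral>x. indicator (A i) x * 1 \<partial>D)"
      by (rule sum.cong) (simp_all add: p_eq A_sets)
    also have "\<dots> = 1" by (subst split) (simp_all add: D.prob_space)
    finally show "(\<Sum>i=1..I. p i) = 1" .
    show "Nseq 0 = 0" by (rule N0)
    show "Nseq k + I \<le> Nseq (Suc k)" for k using N_incr[rule_format, of "Suc k"] by simp
    have "indep_vars (\<lambda>_. borel) (\<lambda>x \<omega>. f ((\<lambda>(i, j). Xs i j) x \<omega>)) ({1..I} \<times> {1..})"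
      by (rule indep_vars_compose2[OF Xs_indep]) measurable
    also have "(\<lambda>x \<omega>. f ((\<lambda>(i, j). Xs i j) x \<omega>)) = (\<lambda>(i, j). Y i j)"
      by (auto simp: fun_eq_iff Y_def)
    finally show "indep_vars (\<lambda>_. borel) (\<lambda>(i, j). Y i j) ({1..I} \<times> {1..})" .
    show "distr M borel (Y i j) = distr M borel (Y i 1)" if "i \<in> {1..I}" "j \<ge> 1" for i j
      using law(3)[OF that, of "\<lambda>x. x"] law(3)[OF that(1), of 1 "\<lambda>x. x"] by simp
    show "integrable M (\<lambda>\<omega>. (Y i 1 \<omega>)\<^sup>2)" if i: "i \<in> {1..I}" for i
    proof -
      have "integrable (\<nu> i) (\<lambda>x. (f x)\<^sup>2)"
        unfolding \<nu>_def
        by (rule integrable_uniform_measure[OF D.prob_space_axioms A_sets[OF i] _ _ f2_D])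
           (use i p_pos in \<open>auto simp: p_eq[symmetric]\<close>)
      then show ?thesis using law(2)[OF i, of 1 "\<lambda>x. x\<^sup>2"] by simp
    qed
    show "\<exists>i\<in>{1..I}. variance (Y i 1) > 0"
      using H sd unfolding \<nu>_def D_def by force
    show "(\<lambda>k. real k / real (Nseq k)) \<longlonglongrightarrow> 0" by (rule k_over_N)
  qed
  \<comment> \<open>The weight p i cancels the normalisation of the conditional law, so the weighted
    stratum means reassemble the integral of f over the partition.\<close>
  have "(\<Sum>i=1..I. p i * \<mu> i) = (\<Sum>i=1..I. \<integral>x. indicator (A i) x * f x \<partial>D)"
  proof (rule sum.cong[OF refl])
    fix i assume i: "i \<in> {1..I}"
    then have "measure D (A i) > 0" using p_pos by (simp add: p_eq[symmetric])
    then show "p i * \<mu> i = (\<integral>x. indicator (A i) x * f x \<partial>D)"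
      unfolding \<mu>_def mean[OF i] \<nu>_def p_eq[OF i]
      by (subst integral_uniform_measure[OF D.prob_space_axioms A_sets[OF i]]) auto
  qed
  also have "\<dots> = integral\<^sup>L M (\<lambda>\<omega>. f (X \<omega>))"
    by (subst split[OF f_D]) (unfold D_def, rule integral_distr, measurable)
  finally have c: "(\<Sum>i=1..I. p i * \<mu> i) = integral\<^sup>L M (\<lambda>\<omega>. f (X \<omega>))" .
  have "\<sigma>star = (\<Sum>i=1..I. p i * law_sd (uniform_measure (distr M borel X) (A i)) f)"
    unfolding \<sigma>star_def by (rule sum.cong) (simp_all only: \<sigma>_def sd[unfolded \<nu>_def D_def])
  with estimator_clt show ?thesis unfolding c Y_def by simp
qed

end
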